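(* Let $D$ be an integral domain with $w$-$\dim(D)<\infty$. Then the following are equivalent: (1) every overring of $D$ (i.e. every ring $T$ with $D\subseteq T\subseteq K$, $K$ the quotient field of $D$) is a $w$-Jaffard domain; (2) $D$ is a quasi-Pr\"ufer domain.
   Context: Let $D$ be an integral domain with quotient field $K$. For a nonzero fractional ideal $A$ of $D$ put $A^{-1}=(D:A)=\{x\in K: xA\subseteq D\}$ and $A^v=(A^{-1})^{-1}$. The $w$-operation is $A^w=\{x\in K: xJ\subseteq A$ for some nonzero finitely generated ideal $J\subseteq D$ with $J^v=D\}$. A $w$-prime of $D$ is a prime ideal $P$ with $P^w=P$, and $w$-$\dim(D)=\sup\{\operatorname{ht}(P): P$ a $w$-prime of $D\}$. A valuation overring $V$ of $D$ is a $w$-valuation overring if $F^w\subseteq FV$ for every nonzero finitely generated fractional ideal $F$ of $D$; the $w$-valuative dimension is $w$-$\dim_v(D)=\sup\{\dim V: V$ a $w$-valuation overring of $D\}$. $D$ is a $w$-Jaffard domain if $w$-$\dim(D)=w$-$\dim_v(D)<\infty$ (for an overring $T$, these notions are taken with respect to the $w$-operation of $T$). $D$ is a quasi-Pr\"ufer domain if for every prime ideal $P$ of $D$ and every prime ideal $Q$ of $D[X]$ with $Q\subseteq P[X]$, one has $Q=(Q\cap D)[X]$. *)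

theory Defs
  imports "HOL-Library.Extended_Nat" "HOL-Computational_Algebra.Polynomial"
begin

text \<open>Rings are subsets of an ambient commutative ring; an integral domain D is a
subring of a field K (the type 'k) whose quotient field is all of K.\<close>

definition subring :: "'a::comm_ring_1 set \<Rightarrow> bool" where
  "subring R \<longleftrightarrow> 0 \<in> R \<and> 1 \<in> R \<and> (\<forall>x\<in>R. \<forall>y\<in>R. x + y \<in> R \<and> x * y \<in> R \<and> - x \<in> R)"

definition ideal_of :: "'a::comm_ring_1 set \<Rightarrow> 'a set \<Rightarrow> bool" where
  "ideal_of R I \<longleftrightarrow> I \<subseteq> R \<and> 0 \<in> I \<and> (\<forall>x\<in>I. \<forall>y\<in>I. x + y \<in> I) \<and> (\<forall>r\<in>R. \<forall>x\<in>I. r * x \<in> I)"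

definition prime_ideal_of :: "'a::comm_ring_1 set \<Rightarrow> 'a set \<Rightarrow> bool" where
  "prime_ideal_of R P \<longleftrightarrow> ideal_of R P \<and> P \<noteq> R \<and>
     (\<forall>x\<in>R. \<forall>y\<in>R. x * y \<in> P \<longrightarrow> x \<in> P \<or> y \<in> P)"

definition height :: "'a::comm_ring_1 set \<Rightarrow> 'a set \<Rightarrow> enat" where
  "height R P = Sup {enat n | n. \<exists>c :: nat \<Rightarrow> 'a set.
      (\<forall>i\<le>n. prime_ideal_of R (c i)) \<and> (\<forall>i<n. c i \<subset> c (Suc i)) \<and> c n = P}"

definition krull_dim :: "'a::comm_ring_1 set \<Rightarrow> enat" where
  "krull_dim R = Sup {height R P | P. prime_ideal_of R P}"

definition gen_submod :: "'k::field set \<Rightarrow> 'k list \<Rightarrow> 'k set" where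
  "gen_submod R as = {sum_list (map2 (*) rs as) | rs. length rs = length as \<and> set rs \<subseteq> R}"

definition fg_frac_ideal :: "'k::field set \<Rightarrow> 'k set \<Rightarrow> bool" where
  "fg_frac_ideal R F \<longleftrightarrow> (\<exists>as. F = gen_submod R as)"

definition fg_ideal :: "'k::field set \<Rightarrow> 'k set \<Rightarrow> bool" where
  "fg_ideal R J \<longleftrightarrow> (\<exists>as. set as \<subseteq> R \<and> J = gen_submod R as)"

definition colon :: "'k::field set \<Rightarrow> 'k set \<Rightarrow> 'k set" where
  "colon R A = {x. \<forall>a\<in>A. x * a \<in> R}"

definition v_op :: "'k::field set \<Rightarrow> 'k set \<Rightarrow> 'k set" where
  "v_op R A = colon R (colon R A)"

definition w_op :: "'k::field set \<Rightarrow> 'k set \<Rightarrow> 'k set" where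
  "w_op R A = {x. \<exists>J. fg_ideal R J \<and> J \<noteq> {0} \<and> v_op R J = R \<and> (\<forall>j\<in>J. x * j \<in> A)}"

definition w_prime :: "'k::field set \<Rightarrow> 'k set \<Rightarrow> bool" where
  "w_prime R P \<longleftrightarrow> prime_ideal_of R P \<and> w_op R P = P"

definition w_dim :: "'k::field set \<Rightarrow> enat" where
  "w_dim R = Sup {height R P | P. w_prime R P}"

definition valuation_overring :: "'k::field set \<Rightarrow> 'k set \<Rightarrow> bool" where
  "valuation_overring R V \<longleftrightarrow> subring V \<and> R \<subseteq> V \<and>
     (\<forall>x. x \<noteq> 0 \<longrightarrow> x \<in> V \<or> inverse x \<in> V)"

definition ext_ideal :: "'k::field set \<Rightarrow> 'k set \<Rightarrow> 'k set" where
  "ext_ideal F V = {sum_list (map2 (*) fs vs) | fs vs.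
      length fs = length vs \<and> set fs \<subseteq> F \<and> set vs \<subseteq> V}"

definition w_valuation_overring :: "'k::field set \<Rightarrow> 'k set \<Rightarrow> bool" where
  "w_valuation_overring R V \<longleftrightarrow> valuation_overring R V \<and>
     (\<forall>F. fg_frac_ideal R F \<and> F \<noteq> {0} \<longrightarrow> w_op R F \<subseteq> ext_ideal F V)"

definition w_dim_v :: "'k::field set \<Rightarrow> enat" where
  "w_dim_v R = Sup {krull_dim V | V. w_valuation_overring R V}"

definition w_Jaffard :: "'k::field set \<Rightarrow> bool" where
  "w_Jaffard R \<longleftrightarrow> w_dim R = w_dim_v R \<and> w_dim R < \<infinity>"

definition poly_ring :: "'a::comm_ring_1 set \<Rightarrow> 'a poly set" where
  "poly_ring D = {p. \<forall>n. coeff p n \<in> D}"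

definition quasi_Pruefer :: "'a::comm_ring_1 set \<Rightarrow> bool" where
  "quasi_Pruefer D \<longleftrightarrow> (\<forall>P Q. prime_ideal_of D P \<longrightarrow> prime_ideal_of (poly_ring D) Q \<longrightarrow>
      Q \<subseteq> poly_ring P \<longrightarrow> Q = poly_ring {a \<in> D. [:a:] \<in> Q})"

end

theory Submission
  imports Defs "HOL-Computational_Algebra.Polynomial_Factorial"
begin

text \<open>Both conditions express incomparability for the valuation overrings of \<open>D\<close>.

  If \<open>D\<close> is quasi-Pruefer, every nonzero \<open>f \<in> K[X]\<close> has, for each prime \<open>P\<close>, a multiple in
  \<open>D[X] - P[X]\<close>, and this is inherited by overrings \<open>T\<close>. Applied to polynomials with a given
  content, it shows through a Dedekind--Mertens argument that \<open>J\<^sup>v = T\<close> forces \<open>J = T\<close>, so the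
  w-operation of \<open>T\<close> is trivial. Applied to linear polynomials, it shows that distinct comparable
  primes of an overring have distinct contractions, so no overring has larger dimension.

  Conversely, let \<open>V\<^sub>2 \<subset> V\<^sub>1\<close> be valuation overrings with the same center \<open>P\<close> on \<open>D\<close> and
  let \<open>M\<close> be the maximal ideal of \<open>V\<^sub>1\<close>. Then \<open>T = D\<^sub>P + M\<close> is local with divisorial maximal ideal
  \<open>M\<close>, so its w-operation is trivial; each of its prime chains, followed by the maximal ideal of \<open>V\<^sub>2\<close>,
  is a prime chain of \<open>V\<^sub>2\<close>, so \<open>T\<close> is not w-Jaffard. Hence in (1) there are no such
  pairs. Given a prime \<open>Q \<subseteq> P[X]\<close>, choose valuation rings \<open>W\<^sub>0 \<supseteq> W\<^sub>1 \<supseteq> W\<^sub>2\<close> of \<open>K(X)\<close> centered on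
  \<open>Q\<close>, \<open>P[X]\<close> and \<open>(P, X)\<close>. Then \<open>W\<^sub>1\<close> and \<open>W\<^sub>2\<close> have the same trace \<open>V\<close> on \<open>K\<close>, which makes every
  polynomial over \<open>V\<close> with a unit coefficient a unit of \<open>W\<^sub>1\<close>. Dividing \<open>f \<in> Q\<close> by a coefficient of
  least value now shows that all coefficients of \<open>f\<close> lie in \<open>Q\<close>.\<close>

subsection \<open>Subrings and ideals\<close>

lemma subringD:
  assumes "subring R"
  shows "0 \<in> R" "1 \<in> R" "x \<in> R \<Longrightarrow> y \<in> R \<Longrightarrow> x + y \<in> R" "x \<in> R \<Longrightarrow> y \<in> R \<Longrightarrow> x * y \<in> R"
    "x \<in> R \<Longrightarrow> - x \<in> R" "x \<in> R \<Longrightarrow> y \<in> R \<Longrightarrow> x - y \<in> R"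
  using assms unfolding subring_def diff_conv_add_uminus by blast+

lemma ideal_ofD:
  assumes "ideal_of R I"
  shows "I \<subseteq> R" "0 \<in> I" "x \<in> I \<Longrightarrow> y \<in> I \<Longrightarrow> x + y \<in> I" "r \<in> R \<Longrightarrow> x \<in> I \<Longrightarrow> r * x \<in> I"
    "r \<in> R \<Longrightarrow> x \<in> I \<Longrightarrow> x * r \<in> I"
  using assms unfolding ideal_of_def by (auto simp: mult.commute)

lemma ideal_of_diff:
  assumes "subring R" "ideal_of R I" "x \<in> I" "y \<in> I"
  shows "x - y \<in> I"
proof -
  have "(- 1) * y \<in> I"
    using subringD(5)[OF assms(1) subringD(2)[OF assms(1)]] ideal_ofD(4)[OF assms(2)] assms(4) by blast
  then show ?thesis
    using ideal_ofD(3)[OF assms(2) assms(3), of "- y"] by simp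
qed

lemma prime_ideal_ofD:
  assumes "prime_ideal_of R P"
  shows "ideal_of R P" "P \<subseteq> R" "x \<in> R \<Longrightarrow> y \<in> R \<Longrightarrow> x * y \<in> P \<Longrightarrow> x \<in> P \<or> y \<in> P"
  using assms unfolding prime_ideal_of_def ideal_of_def by auto

lemma one_notin_prime:
  assumes "prime_ideal_of R P"
  shows "1 \<notin> P"
proof
  assume "1 \<in> P"
  have "r \<in> P" if "r \<in> R" for r
    using ideal_ofD(4)[OF prime_ideal_ofD(1)[OF assms] that \<open>1 \<in> P\<close>] by simp
  then show False
    using assms unfolding prime_ideal_of_def ideal_of_def by blast
qed

lemma prime_ideal_ofI:
  assumes "subring R" "ideal_of R P" "1 \<notin> P"
    "\<And>x y. x \<in> R \<Longrightarrow> y \<in> R \<Longrightarrow> x * y \<in> P \<Longrightarrow> x \<in> P \<or> y \<in> P"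
  shows "prime_ideal_of R P"
  using assms subringD(2)[OF assms(1)] unfolding prime_ideal_of_def by blast

lemma prime_ideal_contract:
  assumes "subring S" "subring R" "R \<subseteq> S" "prime_ideal_of S P"
  shows "prime_ideal_of R (P \<inter> R)"
proof (rule prime_ideal_ofI[OF assms(2)])
  show "ideal_of R (P \<inter> R)"
    using assms(3) ideal_ofD[OF prime_ideal_ofD(1)[OF assms(4)]] subringD[OF assms(2)]
    unfolding ideal_of_def by (auto; meson subsetD)
  show "1 \<notin> P \<inter> R"
    using one_notin_prime[OF assms(4)] by simp
  show "x \<in> P \<inter> R \<or> y \<in> P \<inter> R" if "x \<in> R" "y \<in> R" "x * y \<in> P \<inter> R" for x y
    using that assms(3) prime_ideal_ofD(3)[OF assms(4), of x y] by auto
qed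

lemma sum_list_mem:
  assumes "0 \<in> I" "\<And>x y. x \<in> I \<Longrightarrow> y \<in> I \<Longrightarrow> x + y \<in> I" "set xs \<subseteq> I"
  shows "sum_list xs \<in> I"
  using assms(3) by (induction xs) (auto intro: assms)

lemma sum_list_map2_mem:
  assumes "0 \<in> I" "\<And>x y. x \<in> I \<Longrightarrow> y \<in> I \<Longrightarrow> x + y \<in> I"
    "\<And>f v. f \<in> set fs \<Longrightarrow> v \<in> set vs \<Longrightarrow> f * v \<in> I"
  shows "sum_list (map2 (*) fs vs) \<in> I"
  by (rule sum_list_mem) (auto intro: assms dest: set_zip_leftD set_zip_rightD)

lemma sum_mem:
  assumes "0 \<in> I" "\<And>x y. x \<in> I \<Longrightarrow> y \<in> I \<Longrightarrow> x + y \<in> I" "\<And>i. i \<in> A \<Longrightarrow> f i \<in> I"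
  shows "sum f A \<in> I"
  using assms(3) by (induction A rule: infinite_finite_induct) (auto intro: assms(1,2))

subsection \<open>Polynomials over a subring\<close>

lemma poly_ring_pCons [simp]: "pCons a p \<in> poly_ring R \<longleftrightarrow> a \<in> R \<and> p \<in> poly_ring R"
  unfolding poly_ring_def by (auto simp: coeff_pCons split: nat.splits)

lemma poly_ring_zero: "0 \<in> R \<Longrightarrow> 0 \<in> poly_ring R"
  by (simp add: poly_ring_def)

lemma poly_ring_mult:
  assumes "subring R" "ideal_of R I" "p \<in> poly_ring R" "q \<in> poly_ring I"
  shows "p * q \<in> poly_ring I"
  using assms ideal_ofD[OF assms(2)] by (auto intro!: sum_mem simp: poly_ring_def coeff_mult)

lemma subring_ideal: "subring R \<Longrightarrow> ideal_of R R"
  unfolding subring_def ideal_of_def by auto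

lemma subring_poly_ring:
  assumes "subring R"
  shows "subring (poly_ring R)"
  using poly_ring_mult[OF assms subring_ideal[OF assms]] subringD[OF assms]
  unfolding subring_def by (auto simp: poly_ring_def coeff_1)

lemma poly_ring_mono: "R \<subseteq> S \<Longrightarrow> poly_ring R \<subseteq> poly_ring S"
  unfolding poly_ring_def by auto

lemma ideal_poly_ring:
  assumes "subring R" "ideal_of R I"
  shows "ideal_of (poly_ring R) (poly_ring I)"
  using poly_ring_mono[OF ideal_ofD(1)[OF assms(2)]] poly_ring_mult[OF assms]
    ideal_ofD[OF assms(2)]
  unfolding ideal_of_def by (auto simp: poly_ring_def)

text \<open>Gauss's argument: if \<open>i\<close> and \<open>j\<close> are the least degrees at
  which \<open>p\<close> and \<open>q\<close> have coefficients outside \<open>P\<close>, then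
  modulo \<open>P\<close> the coefficient of \<open>p * q\<close> in degree \<open>i + j\<close> is
  the product of these two.\<close>

lemma prime_poly_ring:
  assumes "subring R" "prime_ideal_of R P"
  shows "prime_ideal_of (poly_ring R) (poly_ring P)"
proof (rule prime_ideal_ofI[OF subring_poly_ring[OF assms(1)] ideal_poly_ring[OF assms(1)]])
  note ideal = prime_ideal_ofD(1)[OF assms(2)]
  show "ideal_of R P" by (rule ideal)
  show "1 \<notin> poly_ring P"
    using one_notin_prime[OF assms(2)] by (auto simp: poly_ring_def coeff_1)
  fix p q :: "'a poly"
  assume pR: "p \<in> poly_ring R" and qR: "q \<in> poly_ring R" and pq: "p * q \<in> poly_ring P"
  show "p \<in> poly_ring P \<or> q \<in> poly_ring P"
  proof (rule ccontr)
    assume "\<not> ?thesis"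
    then have ex: "\<exists>i. coeff p i \<notin> P" "\<exists>i. coeff q i \<notin> P"
      by (auto simp: poly_ring_def)
    define i j where "i = (LEAST i. coeff p i \<notin> P)" and "j = (LEAST i. coeff q i \<notin> P)"
    have i: "coeff p i \<notin> P" "\<And>k. k < i \<Longrightarrow> coeff p k \<in> P"
      unfolding i_def using LeastI_ex[OF ex(1)] by (auto dest: not_less_Least)
    have j: "coeff q j \<notin> P" "\<And>k. k < j \<Longrightarrow> coeff q k \<in> P"
      unfolding j_def using LeastI_ex[OF ex(2)] by (auto dest: not_less_Least)
    have "coeff (p * q) (i + j) =
        coeff p i * coeff q j + (\<Sum>k\<in>{..i + j} - {i}. coeff p k * coeff q (i + j - k))"
      unfolding coeff_mult by (subst sum.remove[of _ i]) auto
    moreover have "(\<Sum>k\<in>{..i + j} - {i}. coeff p k * coeff q (i + j - k)) \<in> P"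
    proof (rule sum_mem)
      fix k assume "k \<in> {..i + j} - {i}"
      then consider "k < i" | "i + j - k < j" by force
      then show "coeff p k * coeff q (i + j - k) \<in> P"
        using i(2) j(2) ideal_ofD[OF ideal] pR qR by cases (auto simp: poly_ring_def)
    qed (use ideal_ofD[OF ideal] in auto)
    moreover have "coeff (p * q) (i + j) \<in> P"
      using pq by (simp add: poly_ring_def)
    ultimately have "coeff p i * coeff q j \<in> P"
      using ideal_of_diff[OF assms(1) ideal] by (metis add_diff_cancel_right')
    then show False
      using prime_ideal_ofD(3)[OF assms(2)] pR qR i(1) j(1) by (auto simp: poly_ring_def)
  qed
qed

lemma poly_mem:
  assumes "subring R" "x \<in> R" "ideal_of R I" "p \<in> poly_ring I"
  shows "poly p x \<in> I"
  using assms(4)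
  by (induction p) (use ideal_ofD[OF assms(3)] assms(2) in \<open>auto simp: pCons_eq_0_iff\<close>)

subsection \<open>Valuation rings\<close>

text \<open>For a valuation ring this is the maximal ideal, and its trace on a subring is the center
  there. Zero is listed separately because \<open>inverse 0 = 0\<close> belongs to every
  subring.\<close>

definition nonunits :: "'k::field set \<Rightarrow> 'k set" where
  "nonunits V = {x \<in> V. x = 0 \<or> inverse x \<notin> V}"

lemma valuation_overringD:
  assumes "valuation_overring R V"
  shows "subring V" "R \<subseteq> V" "x \<notin> V \<Longrightarrow> inverse x \<in> nonunits V"
proof -
  show s: "subring V" "R \<subseteq> V"
    using assms by (auto simp: valuation_overring_def)
  show "inverse x \<in> nonunits V" if "x \<notin> V"
    using assms that subringD(1)[OF s(1)] by (cases "x = 0") (auto simp: valuation_overring_def nonunits_def)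
qed

lemma valuation_overring_mono: "valuation_overring R V \<Longrightarrow> S \<subseteq> V \<Longrightarrow> valuation_overring S V"
  by (simp add: valuation_overring_def)

lemma inverse_mem_of_unit: "x \<in> V \<Longrightarrow> x \<notin> nonunits V \<Longrightarrow> inverse x \<in> V \<and> x \<noteq> 0"
  by (auto simp: nonunits_def)

text \<open>Multiples of nonunits are nonunits. For sums, one of two nonzero elements divides the
  other in \<open>V\<close>, so the sum is a multiple of one of them.\<close>

lemma prime_nonunits:
  assumes V: "valuation_overring R V"
  shows "prime_ideal_of V (nonunits V)"
proof -
  note sV = valuation_overringD(1)[OF V]
  note r = subringD[OF sV]
  have mult: "v * x \<in> nonunits V" if "v \<in> V" "x \<in> nonunits V" for v x
  proof (cases "v * x = 0")
    case False
    have "inverse (v * x) \<notin> V"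
    proof
      assume "inverse (v * x) \<in> V"
      then have "v * inverse (v * x) \<in> V"
        using that r(4) by blast
      moreover have "v * inverse (v * x) = inverse x"
        using False by (simp add: field_simps)
      ultimately show False
        using that False unfolding nonunits_def by (metis (mono_tags) mem_Collect_eq mult_zero_right)
    qed
    then show ?thesis
      using that r(4) by (auto simp: nonunits_def)
  qed (use r(1) in \<open>auto simp: nonunits_def\<close>)
  have add_aux: "x + y \<in> nonunits V"
    if "x \<in> nonunits V" "y \<in> nonunits V" "x \<noteq> 0" "y / x \<in> V" for x y
  proof -
    have "(1 + y / x) * x \<in> nonunits V"
      using that r by (intro mult) auto
    moreover have "(1 + y / x) * x = x + y"
      using that by (simp add: field_simps)
    ultimately show ?thesis by simp
  qed
  have add: "x + y \<in> nonunits V" if xy: "x \<in> nonunits V" "y \<in> nonunits V" for x y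
  proof (cases "x = 0 \<or> y = 0")
    case False
    then have "y / x \<in> V \<or> x / y \<in> V"
      using V unfolding valuation_overring_def by (metis divide_eq_0_iff inverse_divide)
    then show ?thesis
      using add_aux[of x y] add_aux[of y x] xy False by (auto simp: add.commute)
  qed (use that in auto)
  show ?thesis
  proof (rule prime_ideal_ofI[OF sV])
    show "ideal_of V (nonunits V)"
      using add mult r(1) by (auto simp: ideal_of_def nonunits_def)
    show "1 \<notin> nonunits V"
      using r(2) by (auto simp: nonunits_def)
    show "x \<in> nonunits V \<or> y \<in> nonunits V" if "x \<in> V" "y \<in> V" "x * y \<in> nonunits V" for x y
      using that r(4) by (auto simp: nonunits_def)
  qed
qed

text \<open>The inverse of a nonzero nonunit of \<open>V\<close> lies outside \<open>V\<close>,
  hence outside \<open>W\<close>, so the valuation property puts the element itself into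
  \<open>W\<close>.\<close>

lemma nonunits_antimono:
  assumes "valuation_overring R W" "W \<subseteq> V"
  shows "nonunits V \<subseteq> nonunits W"
proof
  fix x assume "x \<in> nonunits V"
  then show "x \<in> nonunits W"
    using assms subringD(1)[OF valuation_overringD(1)[OF assms(1)]] inverse_inverse_eq[of x]
    unfolding nonunits_def valuation_overring_def by (cases "x = 0") auto
qed

lemma nonunits_subset: "nonunits V \<subseteq> V"
  by (auto simp: nonunits_def)

subsection \<open>Existence of valuation rings\<close>

lemma ext_idealI:
  assumes "length fs = length vs" "set fs \<subseteq> F" "set vs \<subseteq> V"
  shows "sum_list (map2 (*) fs vs) \<in> ext_ideal F V"
  using assms unfolding ext_ideal_def by blast

lemma mem_ext_ideal:
  assumes "f \<in> I" "v \<in> R"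
  shows "f * v \<in> ext_ideal I R"
  using ext_idealI[of "[f]" "[v]" I R] assms by simp

lemma ideal_of_ext_ideal:
  assumes "subring R" "I \<subseteq> R"
  shows "ideal_of R (ext_ideal I R)"
proof -
  note r = subringD[OF assms(1)]
  have sub: "ext_ideal I R \<subseteq> R"
  proof
    fix x assume "x \<in> ext_ideal I R"
    then obtain fs vs where *: "x = sum_list (map2 (*) fs vs)" "set fs \<subseteq> I" "set vs \<subseteq> R"
      by (auto simp: ext_ideal_def)
    show "x \<in> R"
      unfolding *(1) using *(2,3) assms(2) r by (intro sum_list_map2_mem) blast+
  qed
  moreover have "0 \<in> ext_ideal I R"
    using ext_idealI[of "[]" "[]"] by simp
  moreover have "x + y \<in> ext_ideal I R" if "x \<in> ext_ideal I R" "y \<in> ext_ideal I R" for x y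
  proof -
    from that obtain fs vs gs ws where
      "x = sum_list (map2 (*) fs vs)" "set fs \<subseteq> I" "set vs \<subseteq> R" "length fs = length vs"
      "y = sum_list (map2 (*) gs ws)" "set gs \<subseteq> I" "set ws \<subseteq> R" "length gs = length ws"
      by (auto simp: ext_ideal_def)
    then show ?thesis
      using ext_idealI[of "fs @ gs" "vs @ ws" I R] by simp
  qed
  moreover have "r * x \<in> ext_ideal I R" if "r \<in> R" "x \<in> ext_ideal I R" for r x
  proof -
    from that obtain fs vs where *:
      "x = sum_list (map2 (*) fs vs)" "set fs \<subseteq> I" "set vs \<subseteq> R" "length fs = length vs"
      by (auto simp: ext_ideal_def)
    have "r * x = sum_list (map2 (*) fs (map ((*) r) vs))"
      unfolding *(1) using *(4) by (induction fs vs rule: list_induct2) (auto simp: algebra_simps)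
    then show ?thesis
      using ext_idealI[of fs "map ((*) r) vs" I R] * that(1) r(4) by auto
  qed
  ultimately show ?thesis
    by (simp add: ideal_of_def)
qed

lemma ext_ideal_ideal:
  assumes "ideal_of R I"
  shows "ext_ideal I R \<subseteq> I"
proof
  fix x assume "x \<in> ext_ideal I R"
  then obtain fs vs where *: "x = sum_list (map2 (*) fs vs)" "set fs \<subseteq> I" "set vs \<subseteq> R"
    by (auto simp: ext_ideal_def)
  show "x \<in> I"
    unfolding *(1) using *(2,3) ideal_ofD[OF assms] by (intro sum_list_map2_mem) blast+
qed

text \<open>Turns membership in the extension of \<open>I\<close> to \<open>R[x]\<close> into a
  polynomial relation with coefficients in \<open>IR\<close>; the case \<open>y = 1\<close> feeds
  the maximality argument for valuation rings.\<close>

lemma ext_ideal_adjoin: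
  assumes R: "subring R" and "I \<subseteq> R" and "y \<in> ext_ideal I {poly p x | p. p \<in> poly_ring R}"
  shows "\<exists>p \<in> poly_ring (ext_ideal I R). poly p x = y"
proof -
  note id = ideal_of_ext_ideal[OF assms(1,2)]
  note r = ideal_ofD[OF id]
  let ?A = "{poly p x | p. p \<in> poly_ring R}" and ?B = "{poly p x | p. p \<in> poly_ring (ext_ideal I R)}"
  from assms(3) obtain fs vs where *: "y = sum_list (map2 (*) fs vs)" "set fs \<subseteq> I" "set vs \<subseteq> ?A"
    by (auto simp: ext_ideal_def)
  have prod: "f * v \<in> ?B" if "f \<in> I" "v \<in> ?A" for f v
  proof -
    from that obtain p where "v = poly p x" "p \<in> poly_ring R" by auto
    then show ?thesis
      using that(1) by (auto simp: poly_ring_def intro!: exI[of _ "smult f p"] mem_ext_ideal)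
  qed
  have "0 \<in> ?B"
    using r by (auto simp: poly_ring_def intro!: exI[of _ 0])
  moreover have "a + b \<in> ?B" if ab: "a \<in> ?B" "b \<in> ?B" for a b
  proof -
    obtain p q where "a = poly p x" "b = poly q x" "p \<in> poly_ring (ext_ideal I R)" "q \<in> poly_ring (ext_ideal I R)"
      using ab by blast
    then show ?thesis
      using r by (auto simp: poly_ring_def intro!: exI[of _ "p + q"])
  qed
  ultimately have "y \<in> ?B"
    unfolding *(1)
  proof (rule sum_list_map2_mem)
    show "f * v \<in> ?B" if "f \<in> set fs" "v \<in> set vs" for f v
      using that *(2,3) by (intro prod) auto
  qed
  then show ?thesis by auto
qed

lemma subring_adjoin:
  assumes "subring R"
  shows "subring {poly p x | p. p \<in> poly_ring R}"
proof -
  note r = subringD[OF subring_poly_ring[OF assms]]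
  show ?thesis
    unfolding subring_def
  proof (intro conjI ballI)
    let ?A = "{poly p x | p. p \<in> poly_ring R}"
    show "0 \<in> ?A" using r(1) by (auto intro!: exI[of _ 0])
    show "1 \<in> ?A" using r(2) by (auto intro!: exI[of _ 1])
    fix a b assume "a \<in> ?A" "b \<in> ?A"
    then obtain p q where pq: "a = poly p x" "b = poly q x" "p \<in> poly_ring R" "q \<in> poly_ring R"
      by blast
    show "a + b \<in> ?A" using pq r(3) by (auto intro!: exI[of _ "p + q"])
    show "a * b \<in> ?A" using pq r(4) by (auto intro!: exI[of _ "p * q"])
    show "- a \<in> ?A" using pq r(5) by (auto intro!: exI[of _ "- p"])
  qed
qed

text \<open>Descent step of Chevalley's theorem. With \<open>v\<close> the constant term of
  \<open>q\<close> and \<open>n\<close> the degree of \<open>p\<close>, multiplying the relation for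
  \<open>inverse x\<close> by \<open>x ^ n\<close> writes \<open>(1 - v) * x ^ n\<close> as a
  polynomial in \<open>x\<close> of smaller degree over \<open>J\<close>. Substituting this into
  \<open>1 - v\<close> times the relation for \<open>p\<close> removes the leading term.\<close>

lemma reduce_relation:
  fixes x :: "'k::field"
  assumes J: "subring W" "ideal_of W J" "1 \<notin> J" and "x \<noteq> 0"
    and p: "p \<in> poly_ring J" "poly p x = 1" and q: "q \<in> poly_ring J" "poly q (inverse x) = 1"
    and le: "degree q \<le> degree p"
  shows "\<exists>p' \<in> poly_ring J. poly p' x = 1 \<and> degree p' < degree p"
proof -
  note r = ideal_ofD[OF J(2)] and w = subringD[OF J(1)]
  define n where "n = degree p"
  have "n > 0"
  proof (rule ccontr)
    assume "\<not> n > 0"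
    then obtain a where "p = [:a:]"
      by (metis degree_eq_zeroE n_def neq0_conv)
    then show False
      using p J(3) by auto
  qed
  then obtain m where n: "n = Suc m"
    by (cases n) auto
  obtain v q1 where q1: "q = pCons v q1" by (cases q) auto
  have v: "v \<in> J" and q1J: "q1 \<in> poly_ring J" using q q1 by auto
  have degq1: "degree q1 \<le> m"
    using le n unfolding n_def[symmetric] q1 by (cases "q1 = 0") auto
  \<comment> \<open>The reversal of \<open>q1\<close>; \<open>degree q \<le> degree p\<close> keeps
    all exponents \<open>m - j\<close> genuine.\<close>
  define s where "s = (\<Sum>j\<le>m. monom (coeff q1 j) (m - j))"
  have s_eval: "poly s x = x ^ n * (1 - v)"
  proof -
    have q1eq: "poly q1 (inverse x) = (\<Sum>j\<le>m. coeff q1 j * inverse x ^ j)"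
      unfolding poly_altdef
      by (rule sum.mono_neutral_left) (use degq1 in \<open>auto simp: coeff_eq_0\<close>)
    have "poly s x = (\<Sum>j\<le>m. coeff q1 j * x ^ (m - j))"
      by (simp add: s_def poly_sum poly_monom)
    also have "\<dots> = (\<Sum>j\<le>m. x ^ m * (coeff q1 j * inverse x ^ j))"
      using \<open>x \<noteq> 0\<close> by (intro sum.cong refl) (simp add: power_diff field_simps)
    also have "\<dots> = x ^ n * (inverse x * poly q1 (inverse x))"
      using \<open>x \<noteq> 0\<close> unfolding q1eq by (simp add: n sum_distrib_left field_simps)
    also have "inverse x * poly q1 (inverse x) = 1 - v"
      using q(2) unfolding q1 by (simp add: algebra_simps)
    finally show ?thesis .
  qed
  have s_J: "s \<in> poly_ring J"
    unfolding s_def poly_ring_def using q1J r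
    by (auto simp: coeff_sum poly_ring_def intro!: sum_mem)
  have s_deg: "degree s \<le> m"
    unfolding s_def by (intro degree_sum_le) (auto intro: order_trans[OF degree_monom_le])
  define u where "u = coeff p n"
  define p0 where "p0 = p - monom u n"
  have p0_deg: "degree p0 \<le> m"
    unfolding p0_def
  proof (rule degree_le, safe)
    fix i assume "m < i"
    then show "coeff (p - monom u n) i = 0"
      using n n_def u_def by (cases "i = n") (auto intro: coeff_eq_0)
  qed
  have uJ: "u \<in> J" using p(1) by (simp add: u_def poly_ring_def)
  have p0_J: "p0 \<in> poly_ring J"
    using p(1) uJ ideal_of_diff[OF J(1,2)] r(2) unfolding p0_def poly_ring_def by auto
  define p' where "p' = [:v:] + smult (1 - v) p0 + smult u s"
  have "poly p' x = v + (1 - v) * (poly p x - u * x ^ n) + u * (x ^ n * (1 - v))"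
    by (simp add: p'_def p0_def poly_monom s_eval)
  also have "\<dots> = 1"
    using p(2) by (simp add: algebra_simps)
  finally have "poly p' x = 1" .
  moreover have "1 - v \<in> W"
    using w(6)[OF w(2)] v r(1) by (meson subsetD)
  then have "p' \<in> poly_ring J"
    using v uJ p0_J s_J r(2-4) w(4) ideal_ofD(1)[OF J(2)]
    unfolding p'_def poly_ring_def mem_Collect_eq coeff_add coeff_smult
    by (intro allI r(3)) (auto simp: coeff_pCons intro!: r(2) r(4) split: nat.splits)
  moreover have "degree p' \<le> m"
    unfolding p'_def by (intro degree_add_le order_trans[OF degree_smult_le]) (auto simp: p0_deg s_deg)
  ultimately show ?thesis
    using n n_def by auto
qed

text \<open>Infinite descent on the sum of the degrees: the longer relation can always be shortened,
  the roles of \<open>x\<close> and \<open>inverse x\<close> being symmetric.\<close>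

lemma no_opposite_relations:
  fixes x :: "'k::field"
  assumes J: "subring W" "ideal_of W J" "1 \<notin> J" and "x \<noteq> 0"
    and "p \<in> poly_ring J" "poly p x = 1" "q \<in> poly_ring J" "poly q (inverse x) = 1"
  shows False
  using assms(4-)
proof (induction "degree p + degree q" arbitrary: p q rule: less_induct)
  case less
  show False
  proof (cases "degree q \<le> degree p")
    case True
    with reduce_relation[OF J less.prems] obtain p' where
      "p' \<in> poly_ring J" "poly p' x = 1" "degree p' < degree p" by blast
    then show False
      using less.hyps[of p' q] less.prems by auto
  next
    case False
    then obtain q' where
      "q' \<in> poly_ring J" "poly q' (inverse x) = 1" "degree q' < degree q"
      using reduce_relation[OF J, of "inverse x" q p] less.prems by auto
    then show False
      using less.hyps[of p q'] less.prems by auto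
  qed
qed

text \<open>Chevalley's theorem. Zorn's lemma yields a ring \<open>W\<close> maximal among those in
  which \<open>I\<close> does not generate the unit ideal. If \<open>x\<close> and
  \<open>inverse x\<close> were both outside \<open>W\<close>, adjoining either would make
  \<open>1\<close> a combination of elements of \<open>I\<close>, producing opposite
  relations.\<close>

lemma valuation_existence:
  fixes B :: "'k::field set"
  assumes B: "subring B" and I: "ideal_of B I" "1 \<notin> I"
  shows "\<exists>V. valuation_overring B V \<and> I \<subseteq> nonunits V"
proof -
  define \<A> where "\<A> = {A. subring A \<and> B \<subseteq> A \<and> 1 \<notin> ext_ideal I A}"
  have "\<exists>W\<in>\<A>. \<forall>X\<in>\<A>. W \<subseteq> X \<longrightarrow> X = W"
  proof (rule subset_Zorn_nonempty)
    show "\<A> \<noteq> {}"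
      using B I ext_ideal_ideal[OF I(1)] unfolding \<A>_def by auto
  next
    fix \<C> assume ne: "\<C> \<noteq> {}" and ch: "subset.chain \<A> \<C>"
    \<comment> \<open>Closure under the operations and a representation of \<open>1\<close> involve
      finitely many elements, so they can be tested inside one member of the chain.\<close>
    have fin: "\<exists>A\<in>\<C>. S \<subseteq> A" if "finite S" "S \<subseteq> \<Union>\<C>" for S
      using finite_subset_Union_chain[OF that ne ch] by blast
    have sub: "\<C> \<subseteq> \<A>"
      using ch by (simp add: subset_chain_def)
    have "subring (\<Union>\<C>)"
    proof -
      have "x + y \<in> \<Union>\<C> \<and> x * y \<in> \<Union>\<C> \<and> - x \<in> \<Union>\<C>" if xy: "x \<in> \<Union>\<C>" "y \<in> \<Union>\<C>" for x y
      proof -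
        obtain A where A: "A \<in> \<C>" "{x, y} \<subseteq> A"
          using fin[of "{x, y}"] xy by auto
        then have "subring A" using sub by (auto simp: \<A>_def)
        from subringD(3-5)[OF this] A(2) have "x + y \<in> A \<and> x * y \<in> A \<and> - x \<in> A" by simp
        with A(1) show ?thesis by blast
      qed
      moreover obtain A where A: "A \<in> \<C>" using ne by auto
      then have "subring A" using sub by (auto simp: \<A>_def)
      ultimately show ?thesis
        using A subringD(1,2)[of A] unfolding subring_def by blast
    qed
    moreover have "1 \<notin> ext_ideal I (\<Union>\<C>)"
    proof
      assume "1 \<in> ext_ideal I (\<Union>\<C>)"
      then obtain fs vs where *: "1 = sum_list (map2 (*) fs vs)" "length fs = length vs" "set fs \<subseteq> I"
        "set vs \<subseteq> \<Union>\<C>"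
        unfolding ext_ideal_def by blast
      then obtain A where "A \<in> \<C>" "set vs \<subseteq> A"
        using fin[of "set vs"] by auto
      then have "1 \<in> ext_ideal I A" "A \<in> \<A>"
        using * sub unfolding ext_ideal_def by blast+
      then show False by (simp add: \<A>_def)
    qed
    ultimately show "\<Union>\<C> \<in> \<A>"
      using ne sub unfolding \<A>_def by blast
  qed
  then obtain W where W: "subring W" "B \<subseteq> W" "1 \<notin> ext_ideal I W"
    and max: "\<And>X. X \<in> \<A> \<Longrightarrow> W \<subseteq> X \<Longrightarrow> X = W"
    unfolding \<A>_def by auto
  have IW: "I \<subseteq> W" using W(2) ideal_ofD(1)[OF I(1)] by auto
  note id = ideal_of_ext_ideal[OF W(1) IW]
  note w = subringD[OF W(1)]
  \<comment> \<open>By maximality \<open>W[x]\<close> is no longer in the family, so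
    \<open>I\<close> generates its unit ideal.\<close>
  have rel: "\<exists>p\<in>poly_ring (ext_ideal I W). poly p x = 1" if "x \<notin> W" for x
  proof -
    let ?A = "{poly p x | p. p \<in> poly_ring W}"
    have "W \<subseteq> ?A"
    proof
      fix a assume "a \<in> W"
      then have "[:a:] \<in> poly_ring W" using w by (auto intro: poly_ring_zero)
      then show "a \<in> ?A" by (auto intro!: exI[of _ "[:a:]"])
    qed
    moreover have "[:0, 1:] \<in> poly_ring W" using w by (auto intro: poly_ring_zero)
    then have "x \<in> ?A" by (auto intro!: exI[of _ "[:0, 1:]"])
    ultimately have "?A \<notin> \<A>" using max[of ?A] that by blast
    then have "1 \<in> ext_ideal I ?A"
      using subring_adjoin[OF W(1)] \<open>W \<subseteq> ?A\<close> W(2) unfolding \<A>_def by blast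
    then show ?thesis
      using ext_ideal_adjoin[OF W(1) IW] by blast
  qed
  have "valuation_overring B W"
    unfolding valuation_overring_def
  proof (intro conjI allI impI W)
    fix x :: 'k assume "x \<noteq> 0"
    show "x \<in> W \<or> inverse x \<in> W"
      using rel[of x] rel[of "inverse x"] no_opposite_relations[OF W(1) id W(3) \<open>x \<noteq> 0\<close>] by blast
  qed
  moreover have "I \<subseteq> nonunits W"
  proof
    fix i assume i: "i \<in> I"
    have "i = 0 \<or> inverse i \<notin> W"
    proof (rule ccontr)
      assume "\<not> ?thesis"
      then have "i * inverse i \<in> ext_ideal I W" and "i \<noteq> 0"
        using mem_ext_ideal[OF i] by blast+
      then show False using W(3) by simp
    qed
    then show "i \<in> nonunits W" using i IW by (auto simp: nonunits_def)
  qed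
  ultimately show ?thesis by blast
qed

subsection \<open>Composite valuation rings\<close>

text \<open>For a valuation ring with maximal ideal \<open>M\<close>, this is the preimage of the localization at
  \<open>N / M\<close> of the image of \<open>R\<close> in the residue field.\<close>

definition glue :: "'k::field set \<Rightarrow> 'k set \<Rightarrow> 'k set \<Rightarrow> 'k set" where
  "glue R N M = {x. \<exists>h\<in>R. \<exists>s\<in>R - N. x - h / s \<in> M}"

text \<open>Since \<open>M\<close> meets \<open>R\<close> inside \<open>N\<close>, elements of
  \<open>R - N\<close> are units of \<open>V\<close>; fractions \<open>h / s\<close> therefore lie
  in \<open>V\<close> and can be added and multiplied modulo \<open>M\<close>. The set
  \<open>?I\<close> is the preimage of the maximal ideal of the localized residue ring.\<close>

lemma
  assumes R: "subring R" and V: "valuation_overring R V" and N: "prime_ideal_of R N"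
    and M: "nonunits V \<inter> R \<subseteq> N"
  shows subring_glue: "subring (glue R N (nonunits V))"
    and ideal_glue: "ideal_of (glue R N (nonunits V)) {x. \<exists>h\<in>N. \<exists>s\<in>R - N. x - h / s \<in> nonunits V}"
      (is "ideal_of ?B ?I")
    and one_notin_glue: "1 \<notin> {x. \<exists>h\<in>N. \<exists>s\<in>R - N. x - h / s \<in> nonunits V}"
    and glue_subset: "glue R N (nonunits V) \<subseteq> V"
proof -
  note r = subringD[OF R] and v = subringD[OF valuation_overringD(1)[OF V]]
  note n = ideal_ofD[OF prime_ideal_ofD(1)[OF N]]
  note m = ideal_ofD[OF prime_ideal_ofD(1)[OF prime_nonunits[OF V]]]
  have RV: "R \<subseteq> V" by (rule valuation_overringD(2)[OF V])
  have s_mult: "s * s' \<in> R - N" if "s \<in> R - N" "s' \<in> R - N" for s s'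
    using that r(4) prime_ideal_ofD(3)[OF N] by blast
  have s_unit: "s \<noteq> 0" "inverse s \<in> V" if "s \<in> R - N" for s
    using inverse_mem_of_unit[of s V] that RV M by blast+
  have frac: "h / s \<in> V" if "h \<in> R" "s \<in> R - N" for h s
    using s_unit(2)[OF that(2)] that(1) RV v(4) by (auto simp: divide_inverse)
  show sub: "?B \<subseteq> V"
  proof
    fix x assume "x \<in> ?B"
    then obtain h s where hs: "h \<in> R" "s \<in> R - N" "x - h / s \<in> nonunits V"
      by (auto simp: glue_def)
    then have "(x - h / s) + h / s \<in> V"
      using frac nonunits_subset by (intro v(3)) auto
    then show "x \<in> V" by simp
  qed
  have plus: "(x + y) - (h * s' + h' * s) / (s * s') \<in> nonunits V"
    if "s \<in> R - N" "s' \<in> R - N" "x - h / s \<in> nonunits V" "y - h' / s' \<in> nonunits V" for x y h h' s s'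
  proof -
    have "(x - h / s) + (y - h' / s') = (x + y) - (h * s' + h' * s) / (s * s')"
      using s_unit(1)[OF that(1)] s_unit(1)[OF that(2)] by (simp add: field_simps)
    then show ?thesis using m(3)[OF that(3,4)] by (simp only:)
  qed
  have times: "x * y - (h * h') / (s * s') \<in> nonunits V"
    if "h \<in> R" "s \<in> R - N" "s' \<in> R - N" "x - h / s \<in> nonunits V" "y \<in> V" "y - h' / s' \<in> nonunits V"
    for x y h h' s s'
  proof -
    have "y * (x - h / s) + (h / s) * (y - h' / s') \<in> nonunits V"
      using that frac by (intro m(3) m(4))
    moreover have "y * (x - h / s) + (h / s) * (y - h' / s') = x * y - (h * h') / (s * s')"
      by (simp add: algebra_simps)
    ultimately show ?thesis by simp
  qed
  have one: "1 \<in> R - N" using r(2) one_notin_prime[OF N] by blast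
  show "subring ?B"
    unfolding subring_def
  proof (intro conjI ballI)
    have "x - x / 1 \<in> nonunits V" for x using m(2) by simp
    then show "0 \<in> ?B" "1 \<in> ?B" unfolding glue_def using r(1,2) one by blast+
    fix x y assume "x \<in> ?B" "y \<in> ?B"
    then obtain h s h' s' where *: "h \<in> R" "s \<in> R - N" "x - h / s \<in> nonunits V"
      "h' \<in> R" "s' \<in> R - N" "y - h' / s' \<in> nonunits V" by (auto simp: glue_def)
    show "x + y \<in> ?B" using plus[OF *(2,5,3,6)] s_mult[OF *(2,5)] *(1,2,4,5) r unfolding glue_def by blast
    show "x * y \<in> ?B"
      using times[OF *(1,2,5,3) _ *(6)] \<open>y \<in> ?B\<close> sub s_mult[OF *(2,5)] r(4)[OF *(1,4)] unfolding glue_def by blast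
    have "(- 1) * (x - h / s) \<in> nonunits V" using * v by (intro m(4)) auto
    then have "- x - (- h) / s \<in> nonunits V" by (simp add: algebra_simps)
    then show "- x \<in> ?B" using *(1,2) r(5) unfolding glue_def by blast
  qed
  show "ideal_of ?B ?I"
    unfolding ideal_of_def
  proof (intro conjI ballI)
    show "?I \<subseteq> ?B" unfolding glue_def using n(1) by blast
    have "x - x / 1 \<in> nonunits V" for x using m(2) by simp
    then show "0 \<in> ?I" using n(2) one by blast
    show "x + y \<in> ?I" if xy: "x \<in> ?I" "y \<in> ?I" for x y
    proof -
      from xy obtain h s h' s' where *: "h \<in> N" "s \<in> R - N" "x - h / s \<in> nonunits V"
        "h' \<in> N" "s' \<in> R - N" "y - h' / s' \<in> nonunits V" by auto
      then have "h * s' + h' * s \<in> N" using n(3,5) by blast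
      then show ?thesis using plus[OF *(2,5,3,6)] s_mult[OF *(2,5)] by blast
    qed
    show "x * y \<in> ?I" if xy: "x \<in> ?B" "y \<in> ?I" for x y
    proof -
      from xy obtain h s h' s' where *: "h \<in> R" "s \<in> R - N" "x - h / s \<in> nonunits V"
        "h' \<in> N" "s' \<in> R - N" "y - h' / s' \<in> nonunits V" by (auto simp: glue_def)
      have "y \<in> ?B" using * n(1) unfolding glue_def by blast
      then show ?thesis
        using times[OF *(1,2,5,3) _ *(6)] sub s_mult[OF *(2,5)] n(4)[OF *(1,4)] by blast
    qed
  qed
  \<comment> \<open>Otherwise \<open>s - h\<close> would lie in \<open>M\<close> and in
    \<open>R\<close>, hence in \<open>N\<close>, and so would \<open>s\<close>.\<close>
  show "1 \<notin> ?I"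
  proof
    assume "1 \<in> ?I"
    then obtain h s where *: "h \<in> N" "s \<in> R - N" "1 - h / s \<in> nonunits V" by blast
    have "s * (1 - h / s) \<in> nonunits V" using * RV by (intro m(4)) auto
    then have "s - h \<in> nonunits V" using s_unit(1)[OF *(2)] by (simp add: algebra_simps)
    moreover have "s - h \<in> R" using * n(1) r(6) by blast
    ultimately have "s - h \<in> N" using M by blast
    then have "(s - h) + h \<in> N" using n(3) * by blast
    then show False using * by simp
  qed
qed

text \<open>Take a valuation ring \<open>W\<close> above the glued ring whose maximal ideal contains
  \<open>?I\<close>. As \<open>M\<close> consists of nonunits of \<open>W\<close>, no element of
  \<open>W\<close> can lie outside \<open>V\<close>; as \<open>R - N\<close> is inverted in the
  glued ring, the center is no larger than \<open>N\<close>.\<close>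

lemma valuation_refine:
  assumes R: "subring R" and V: "valuation_overring R V" and N: "prime_ideal_of R N"
    and M: "nonunits V \<inter> R \<subseteq> N"
  shows "\<exists>W. valuation_overring R W \<and> W \<subseteq> V \<and> nonunits W \<inter> R = N"
proof -
  let ?I = "{x. \<exists>h\<in>N. \<exists>s\<in>R - N. x - h / s \<in> nonunits V}"
  note r = subringD[OF R] and n = ideal_ofD[OF prime_ideal_ofD(1)[OF N]]
  note m = ideal_ofD[OF prime_ideal_ofD(1)[OF prime_nonunits[OF V]]]
  from valuation_existence[OF subring_glue[OF assms] ideal_glue[OF assms] one_notin_glue[OF assms]]
  obtain W where W: "valuation_overring (glue R N (nonunits V)) W" "?I \<subseteq> nonunits W" by blast
  have one: "1 \<in> R - N" using r(2) one_notin_prime[OF N] by blast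
  have h1: "x - x / 1 \<in> nonunits V" for x using m(2) by simp
  have RB: "R \<subseteq> glue R N (nonunits V)" unfolding glue_def using one h1 by blast
  have NI: "N \<subseteq> ?I" using one h1 by blast
  have "x - 0 / 1 \<in> nonunits V" if "x \<in> nonunits V" for x using that by simp
  then have MI: "nonunits V \<subseteq> ?I" using one n(2) by blast
  have "valuation_overring R W"
    using W(1) RB valuation_overringD(2) by (intro valuation_overring_mono[OF W(1)]) blast
  moreover have "W \<subseteq> V"
  proof
    fix x assume "x \<in> W"
    show "x \<in> V"
    proof (rule ccontr)
      assume "x \<notin> V"
      then have "inverse x \<in> nonunits W"
        using valuation_overringD(3)[OF V] MI W(2) by blast
      then have "x = 0" using \<open>x \<in> W\<close> by (auto simp: nonunits_def)
      then show False using \<open>x \<notin> V\<close> valuation_overringD(1)[OF V] subringD(1) by blast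
    qed
  qed
  moreover have "nonunits W \<inter> R \<subseteq> N"
  proof (rule ccontr)
    assume "\<not> ?thesis"
    then obtain s where s: "s \<in> nonunits W" "s \<in> R - N" by blast
    have "inverse s - 1 / s \<in> nonunits V" using m(2) by (simp add: divide_inverse)
    then have "inverse s \<in> W"
      using s one valuation_overringD(2)[OF W(1)] unfolding glue_def by blast
    then show False using s n(2) by (auto simp: nonunits_def)
  qed
  ultimately show ?thesis using NI W(2) n(1) by blast
qed

lemma valuation_overring_UNIV: "valuation_overring R UNIV" "nonunits UNIV = {0}"
  by (auto simp: valuation_overring_def subring_def nonunits_def)

lemma prime_restrict:
  assumes "subring W" "W \<subseteq> V" "prime_ideal_of V p" "p \<subseteq> W"
  shows "prime_ideal_of W p"
proof (rule prime_ideal_ofI[OF assms(1)])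
  show "ideal_of W p"
    using ideal_ofD[OF prime_ideal_ofD(1)[OF assms(3)]] assms(2,4) unfolding ideal_of_def by blast
  show "1 \<notin> p" by (rule one_notin_prime[OF assms(3)])
  show "x \<in> p \<or> y \<in> p" if "x \<in> W" "y \<in> W" "x * y \<in> p" for x y
    using that assms(2) prime_ideal_ofD(3)[OF assms(3), of x y] by blast
qed

text \<open>Refinement of the trivial valuation ring \<open>UNIV\<close>, whose center is
  zero.\<close>

lemma exists_valuation_centered:
  assumes R: "subring R" and N: "prime_ideal_of R N"
  shows "\<exists>W. valuation_overring R W \<and> nonunits W \<inter> R = N"
  using valuation_refine[OF R valuation_overring_UNIV(1) N] ideal_ofD(2)[OF prime_ideal_ofD(1)[OF N]]
  unfolding valuation_overring_UNIV(2) by blast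

subsection \<open>Chains of primes\<close>

text \<open>The chains measured by \<open>height\<close>, with the top prime left free;
  \<open>n\<close> counts strict inclusions rather than primes.\<close>

definition prime_chain :: "'a::comm_ring_1 set \<Rightarrow> nat \<Rightarrow> (nat \<Rightarrow> 'a set) \<Rightarrow> bool" where
  "prime_chain R n c \<longleftrightarrow> (\<forall>i\<le>n. prime_ideal_of R (c i)) \<and> (\<forall>i<n. c i \<subset> c (Suc i))"

lemma prime_chain_le_krull_dim:
  assumes "prime_chain R n c"
  shows "enat n \<le> krull_dim R"
proof -
  have "enat n \<le> height R (c n)"
    unfolding height_def using assms by (intro Sup_upper) (auto simp: prime_chain_def)
  also have "\<dots> \<le> krull_dim R"
    unfolding krull_dim_def using assms by (intro Sup_upper) (auto simp: prime_chain_def)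
  finally show ?thesis .
qed

lemma krull_dim_le:
  assumes "\<And>n c. prime_chain R n c \<Longrightarrow> enat n \<le> B"
  shows "krull_dim R \<le> B"
  unfolding krull_dim_def height_def
  using assms by (auto intro!: Sup_least simp: prime_chain_def)

lemma prime_chain_mono:
  assumes "prime_chain R n c" "i \<le> j" "j \<le> n"
  shows "c i \<subseteq> c j"
  using assms(2,3)
proof (induction j rule: dec_induct)
  case (step j)
  then have "c j \<subset> c (Suc j)" using assms(1) by (simp add: prime_chain_def)
  then show ?case using step by auto
qed auto

lemma prime_chain_extend:
  assumes "prime_chain R n c" "prime_ideal_of R p" "c n \<subset> p"
  shows "prime_chain R (Suc n) (c(Suc n := p))"
  using assms by (auto simp: prime_chain_def le_Suc_eq less_Suc_eq)

text \<open>The valuation ring is refined once for each further prime. Primes of \<open>V\<close>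
  stay prime in the refinement \<open>W\<close>, because they are contained in
  \<open>nonunits V\<close> and thus in \<open>W\<close>. This bounds the dimension of
  \<open>R\<close> by its valuative dimension.\<close>

lemma valuation_chain:
  assumes R: "subring R" and "prime_chain R n c"
  shows "\<exists>V d. valuation_overring R V \<and> prime_chain V n d \<and> d n = nonunits V \<and> nonunits V \<inter> R = c n"
  using assms(2)
proof (induction n)
  case 0
  then obtain W where "valuation_overring R W" "nonunits W \<inter> R = c 0"
    using exists_valuation_centered[OF R] by (auto simp: prime_chain_def)
  then show ?case
    using prime_nonunits[of R W] by (auto simp: prime_chain_def intro!: exI[of _ W] exI[of _ "\<lambda>_. nonunits W"])
next
  case (Suc n)
  then have c: "prime_chain R n c" "c n \<subset> c (Suc n)" "prime_ideal_of R (c (Suc n))"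
    by (auto simp: prime_chain_def)
  obtain V d where V: "valuation_overring R V" "prime_chain V n d" "d n = nonunits V"
    "nonunits V \<inter> R = c n" using Suc.IH[OF c(1)] by blast
  obtain W where W: "valuation_overring R W" "W \<subseteq> V" "nonunits W \<inter> R = c (Suc n)"
    using valuation_refine[OF R V(1) c(3)] V(4) c(2) by blast
  have sub: "nonunits V \<subseteq> nonunits W" by (rule nonunits_antimono[OF W(1,2)])
  have "prime_ideal_of W (d i)" if "i \<le> n" for i
  proof (rule prime_restrict[OF valuation_overringD(1)[OF W(1)] W(2)])
    show "prime_ideal_of V (d i)" using V(2) that by (simp add: prime_chain_def)
    show "d i \<subseteq> W"
      using prime_chain_mono[OF V(2) that order_refl] V(3) sub nonunits_subset[of W] by blast
  qed
  then have "prime_chain W n d" using V(2) by (simp add: prime_chain_def)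
  \<comment> \<open>The inclusion is strict since the two centers on \<open>R\<close>
    differ.\<close>
  moreover have "d n \<subset> nonunits W" using sub V(3,4) W(3) c(2) by blast
  ultimately have "prime_chain W (Suc n) (d(Suc n := nonunits W))"
    using prime_chain_extend prime_nonunits[OF W(1)] by blast
  then show ?case using W by (auto intro!: exI[of _ W] exI[of _ "d(Suc n := nonunits W)"])
qed

subsection \<open>The w-operation when it is trivial\<close>

lemma gen_submod_Nil: "gen_submod R [] = {0}"
  by (auto simp: gen_submod_def)

lemma gen_submod_Cons: "gen_submod R (a # as) = {r * a + y | r y. r \<in> R \<and> y \<in> gen_submod R as}"
proof (rule set_eqI, rule iffI)
  fix x assume "x \<in> gen_submod R (a # as)"
  then obtain rs where *: "x = sum_list (map2 (*) rs (a # as))" "length rs = Suc (length as)" "set rs \<subseteq> R"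
    by (auto simp: gen_submod_def)
  then obtain r rs' where "rs = r # rs'" by (cases rs) auto
  with * show "x \<in> {r * a + y | r y. r \<in> R \<and> y \<in> gen_submod R as}"
    by (auto simp: gen_submod_def)
next
  fix x assume "x \<in> {r * a + y | r y. r \<in> R \<and> y \<in> gen_submod R as}"
  then obtain r rs where *: "x = r * a + sum_list (map2 (*) rs as)" "length rs = length as" "set rs \<subseteq> R" "r \<in> R"
    by (auto simp: gen_submod_def)
  then have "x = sum_list (map2 (*) (r # rs) (a # as))" "length (r # rs) = length (a # as)" "set (r # rs) \<subseteq> R"
    by auto
  then show "x \<in> gen_submod R (a # as)"
    unfolding gen_submod_def by blast
qed

lemma gen_submod_least:
  assumes "0 \<in> I" "\<And>x y. x \<in> I \<Longrightarrow> y \<in> I \<Longrightarrow> x + y \<in> I"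
    "\<And>r a. r \<in> R \<Longrightarrow> a \<in> set as \<Longrightarrow> r * a \<in> I"
  shows "gen_submod R as \<subseteq> I"
  using assms(3) by (induction as) (auto simp: gen_submod_Nil gen_submod_Cons intro!: assms(1,2))

lemma gen_submod_generator:
  assumes "subring R" "a \<in> set as"
  shows "a \<in> gen_submod R as"
proof -
  note r = subringD[OF assms(1)]
  have zero: "0 \<in> gen_submod R bs" for bs
    using r(1) by (induction bs) (force simp: gen_submod_Nil gen_submod_Cons)+
  show ?thesis
    using assms(2)
  proof (induction as)
    case (Cons b as)
    consider "a = b" | "a \<in> gen_submod R as" using Cons by auto
    then show ?case
    proof cases
      case 1
      then have "a = 1 * b + 0" by simp
      then show ?thesis unfolding gen_submod_Cons using r(2) zero by blast
    next
      case 2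
      moreover have "a = 0 * b + a" by simp
      ultimately show ?thesis unfolding gen_submod_Cons using r(1) by blast
    qed
  qed auto
qed

lemma ideal_gen_submod:
  assumes R: "subring R" and "set as \<subseteq> R"
  shows "ideal_of R (gen_submod R as)"
  using assms(2)
proof (induction as)
  case Nil
  then show ?case using subringD(1)[OF R] by (auto simp: gen_submod_Nil ideal_of_def)
next
  case (Cons b as)
  note r = subringD[OF R]
  have IH: "ideal_of R (gen_submod R as)" using Cons by auto
  note i = ideal_ofD[OF IH]
  show ?case
    unfolding ideal_of_def
  proof (intro conjI ballI)
    show "gen_submod R (b # as) \<subseteq> R"
      unfolding gen_submod_Cons using Cons.prems i(1) r(3,4) by auto
    have "0 = 0 * b + 0" by simp
    then show "0 \<in> gen_submod R (b # as)"
      unfolding gen_submod_Cons using r(1) i(2) by blast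
  next
    fix x y assume "x \<in> gen_submod R (b # as)" "y \<in> gen_submod R (b # as)"
    then obtain r s u v where "x = r * b + u" "y = s * b + v" "r \<in> R" "s \<in> R"
      "u \<in> gen_submod R as" "v \<in> gen_submod R as" by (auto simp: gen_submod_Cons)
    moreover from this have "x + y = (r + s) * b + (u + v)" by (simp add: algebra_simps)
    ultimately show "x + y \<in> gen_submod R (b # as)"
      unfolding gen_submod_Cons using r(3) i(3) by blast
  next
    fix t x assume "t \<in> R" "x \<in> gen_submod R (b # as)"
    moreover from this obtain r u where "x = r * b + u" "r \<in> R" "u \<in> gen_submod R as"
      by (auto simp: gen_submod_Cons)
    moreover from this have "t * x = (t * r) * b + t * u" by (simp add: algebra_simps)
    ultimately show "t * x \<in> gen_submod R (b # as)"
      unfolding gen_submod_Cons using r(4) i(4) by blast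
  qed
qed

text \<open>The DW-domains: exactly here every \<open>J\<close> occurring in the w-operation is the
  unit ideal.\<close>

definition dw_domain :: "'k::field set \<Rightarrow> bool" where
  "dw_domain R \<longleftrightarrow> (\<forall>J. fg_ideal R J \<longrightarrow> J \<noteq> {0} \<longrightarrow> v_op R J = R \<longrightarrow> 1 \<in> J)"

lemma dw_domain_w_op: "dw_domain R \<Longrightarrow> w_op R A \<subseteq> A"
  unfolding dw_domain_def w_op_def by force

text \<open>The witness is \<open>J = R\<close>, generated by 1 and equal to its own
  v-closure.\<close>

lemma subset_w_op:
  assumes R: "subring R" and "ideal_of R A"
  shows "A \<subseteq> w_op R A"
proof
  fix x assume x: "x \<in> A"
  note r = subringD[OF R]
  have g: "gen_submod R [1] = R"
    by (auto simp: gen_submod_Nil gen_submod_Cons)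
  have "fg_ideal R R"
    unfolding fg_ideal_def using r(2) g by (intro exI[of _ "[1]"]) simp
  moreover have "R \<noteq> {0}" using r(2) by auto
  moreover have "colon R R = R"
    unfolding colon_def using r(2,4) by fastforce
  ultimately show "x \<in> w_op R A"
    unfolding w_op_def v_op_def using ideal_ofD(5)[OF assms(2)] x by auto
qed

lemma dw_domain_w_dim:
  assumes "subring R" "dw_domain R"
  shows "w_dim R = krull_dim R"
proof -
  have "w_prime R P \<longleftrightarrow> prime_ideal_of R P" for P
    using dw_domain_w_op[OF assms(2), of P] subset_w_op[OF assms(1), of P] prime_ideal_ofD(1)[of R P]
    by (auto simp: w_prime_def)
  then show ?thesis by (simp add: w_dim_def krull_dim_def)
qed

text \<open>With a trivial w-operation the w-valuation condition reduces to the inclusion of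
  \<open>F\<close> in \<open>FV\<close>, which always holds.\<close>

lemma dw_domain_w_dim_v:
  assumes "dw_domain R"
  shows "w_dim_v R = Sup {krull_dim V | V. valuation_overring R V}"
proof -
  have "F \<subseteq> ext_ideal F V" if "valuation_overring R V" for F V
  proof
    fix x assume "x \<in> F"
    then have "x * 1 \<in> ext_ideal F V"
      using valuation_overringD(1)[OF that] subringD(2) by (intro mem_ext_ideal)
    then show "x \<in> ext_ideal F V" by simp
  qed
  then have "w_valuation_overring R V \<longleftrightarrow> valuation_overring R V" for V
    unfolding w_valuation_overring_def using dw_domain_w_op[OF assms] by blast
  then show ?thesis by (simp add: w_dim_v_def)
qed

subsection \<open>Uppers to zero\<close>

text \<open>For irreducible \<open>f\<close> this says that the upper to zero \<open>f K[X] \<inter> R[X]\<close> is not contained in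
  \<open>P[X]\<close>; the general case follows because \<open>P[X]\<close> is prime.\<close>

definition no_upper_in_extension :: "'k::field set \<Rightarrow> bool" where
  "no_upper_in_extension R \<longleftrightarrow>
    (\<forall>P f. prime_ideal_of R P \<longrightarrow> f \<noteq> 0 \<longrightarrow> (\<exists>k. f * k \<in> poly_ring R - poly_ring P))"

lemma clear_denominators:
  fixes D :: "'k::field set"
  assumes D: "subring D" and q: "\<forall>x. \<exists>a\<in>D. \<exists>b\<in>D. b \<noteq> 0 \<and> x = a / b"
  shows "\<exists>d\<in>D. d \<noteq> 0 \<and> smult d f \<in> poly_ring D"
proof (induction f)
  case 0
  then show ?case using subringD[OF D] by (auto intro!: bexI[of _ 1] poly_ring_zero)
next
  case (pCons a f)
  then obtain d where d: "d \<in> D" "d \<noteq> 0" "smult d f \<in> poly_ring D" by blast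
  obtain u v where uv: "u \<in> D" "v \<in> D" "v \<noteq> 0" "a = u / v" using q by blast
  have "(d * v) * a = d * u" using uv by simp
  moreover have "smult (d * v) f = [:v:] * smult d f" by (simp add: mult.commute)
  moreover have "[:v:] * smult d f \<in> poly_ring D"
    using d uv subringD(1)[OF D] by (intro subringD(4)[OF subring_poly_ring[OF D]]) (auto intro: poly_ring_zero)
  ultimately show ?case
    using d uv subringD(4)[OF D] by (intro bexI[of _ "d * v"]) auto
qed

text \<open>Induction on the degree: constants are invertible, irreducible polynomials are handled
  by an upper to zero, and products are handled factor by factor because \<open>P[X]\<close> is
  prime.\<close>

lemma quasi_Pruefer_no_upper:
  fixes D :: "'k::field set"
  assumes D: "subring D" and q: "\<forall>x. \<exists>a\<in>D. \<exists>b\<in>D. b \<noteq> 0 \<and> x = a / b" and QP: "quasi_Pruefer D"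
  shows "no_upper_in_extension D"
  unfolding no_upper_in_extension_def
proof (intro allI impI)
  fix P :: "'k set" and f :: "'k poly"
  assume P: "prime_ideal_of D P" and "f \<noteq> 0"
  note DX = subring_poly_ring[OF D]
  note PX = prime_poly_ring[OF D P]
  show "\<exists>k. f * k \<in> poly_ring D - poly_ring P"
    using \<open>f \<noteq> 0\<close>
  proof (induction "degree f" arbitrary: f rule: less_induct)
    case less
    consider "degree f = 0" | "irreducible f" "degree f > 0" | "degree f > 0" "\<not> irreducible f" by blast
    then show ?case
    proof cases
      case 1
      then obtain a where "f = [:a:]" by (auto elim: degree_eq_zeroE)
      then have "f * [:inverse a:] = 1" using less.prems by (auto simp: one_pCons)
      then show ?thesis using subringD(2)[OF DX] one_notin_prime[OF PX] by (intro exI[of _ "[:inverse a:]"]) auto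
    next
      case 2
      have pr: "prime_elem f" by (rule field_poly_irreducible_imp_prime[OF 2(1)])
      \<comment> \<open>The upper to zero attached to \<open>f\<close>. It contains no nonzero
        constant, yet it contains the nonzero polynomial \<open>smult d f\<close>, so it is not
        extended from \<open>D\<close> and cannot lie in \<open>P[X]\<close>.\<close>
      define Q where "Q = {g \<in> poly_ring D. f dvd g}"
      have "prime_ideal_of (poly_ring D) Q"
      proof (rule prime_ideal_ofI[OF DX])
        show "ideal_of (poly_ring D) Q"
          using subringD[OF DX] unfolding ideal_of_def Q_def by auto
        show "1 \<notin> Q" using pr by (auto simp: Q_def prime_elem_def)
        show "g \<in> Q \<or> h \<in> Q" if "g \<in> poly_ring D" "h \<in> poly_ring D" "g * h \<in> Q" for g h
          using that pr by (auto simp: Q_def prime_elem_dvd_mult_iff)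
      qed
      moreover have const: "a = 0" if "[:a:] \<in> Q" for a
      proof (rule ccontr)
        assume "a \<noteq> 0"
        with that have "degree f \<le> degree [:a:]" by (intro dvd_imp_degree_le) (auto simp: Q_def)
        then show False using 2 by simp
      qed
      obtain d where d: "d \<in> D" "d \<noteq> 0" "smult d f \<in> poly_ring D"
        using clear_denominators[OF D q] by blast
      have "smult d f \<in> Q" using d by (auto simp: Q_def dvd_smult)
      have "Q \<noteq> poly_ring {a \<in> D. [:a:] \<in> Q}"
      proof
        assume "Q = poly_ring {a \<in> D. [:a:] \<in> Q}"
        then have "[:coeff (smult d f) i:] \<in> Q" for i
          using \<open>smult d f \<in> Q\<close> unfolding poly_ring_def by blast
        then have "coeff (smult d f) i = 0" for i using const by blast
        then have "smult d f = 0" by (intro poly_eqI) (simp only: coeff_0)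
        then show False using d less.prems by simp
      qed
      ultimately have "\<not> Q \<subseteq> poly_ring P" using QP P unfolding quasi_Pruefer_def by blast
      then show ?thesis unfolding Q_def by (auto elim!: dvdE)
    next
      case 3
      then have "\<not> is_unit f" using less.prems by (simp add: is_unit_iff_degree)
      with 3 less.prems obtain a b where ab: "f = a * b" "\<not> is_unit a" "\<not> is_unit b"
        by (auto simp: irreducible_def)
      then have nz: "a \<noteq> 0" "b \<noteq> 0" using less.prems by auto
      then have "degree a > 0" "degree b > 0" using ab by (auto simp: is_unit_iff_degree)
      then have "degree a < degree f" "degree b < degree f"
        using nz unfolding ab(1) by (auto simp: degree_mult_eq)
      then obtain k l where "a * k \<in> poly_ring D - poly_ring P" "b * l \<in> poly_ring D - poly_ring P"
        using less.hyps nz by blast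
      then have "(a * k) * (b * l) \<in> poly_ring D - poly_ring P"
        using subringD(4)[OF DX] prime_ideal_ofD(3)[OF PX] by blast
      moreover have "(a * k) * (b * l) = f * (k * l)" by (simp add: ab(1) algebra_simps)
      ultimately show ?thesis by auto
    qed
  qed
qed

section \<open>Overrings: inheritance, incomparability of primes, dimension\<close>

lemma no_upper_in_extension_overring:
  assumes "subring D" "subring T" "D \<subseteq> T" "no_upper_in_extension D"
  shows "no_upper_in_extension T"
  unfolding no_upper_in_extension_def
proof (intro allI impI)
  fix P :: "'a set" and f :: "'a poly"
  assume P: "prime_ideal_of T P" and "f \<noteq> 0"
  \<comment> \<open>Test polynomials have coefficients in all of \<open>K\<close>, so the
    contraction \<open>P \<inter> D\<close> already supplies a multiplier for
    \<open>P\<close>.\<close>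
  then obtain k where k: "f * k \<in> poly_ring D - poly_ring (P \<inter> D)"
    using assms(4) prime_ideal_contract[OF assms(2,1,3) P] unfolding no_upper_in_extension_def by blast
  then have "f * k \<in> poly_ring T - poly_ring P"
    using assms(3) by (auto simp: poly_ring_def)
  then show "\<exists>k. f * k \<in> poly_ring T - poly_ring P" ..
qed

text \<open>For \<open>x\<close> in \<open>P2 - P1\<close>, the condition applied to
  \<open>X - x\<close> gives a polynomial over \<open>T\<close> that vanishes at \<open>x\<close>
  but has a coefficient outside \<open>P1\<close>. Equality of the contractions rules this
  out.\<close>

lemma incomparability:
  assumes T: "subring T" and S: "subring S" "T \<subseteq> S" and up: "no_upper_in_extension T"
    and P: "prime_ideal_of S P1" "prime_ideal_of S P2" "P1 \<subseteq> P2" "P1 \<inter> T = P2 \<inter> T"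
  shows "P1 = P2"
proof (rule ccontr)
  assume "P1 \<noteq> P2"
  then obtain x where x: "x \<in> P2" "x \<notin> P1" using P(3) by blast
  note i1 = ideal_ofD[OF prime_ideal_ofD(1)[OF P(1)]] and i2 = ideal_ofD[OF prime_ideal_ofD(1)[OF P(2)]]
  have xS: "x \<in> S" using x i2 by blast
  have "[:- x, 1:] \<noteq> 0" by simp
  then obtain k where k: "[:- x, 1:] * k \<in> poly_ring T - poly_ring (P1 \<inter> T)"
    using up prime_ideal_contract[OF S(1) T S(2) P(1)] unfolding no_upper_in_extension_def by blast
  \<comment> \<open>Horner induction: reducing modulo \<open>P2\<close>, which contains
    \<open>x\<close>, puts the constant term into \<open>P2 \<inter> T\<close> and so into
    \<open>P1\<close>; subtracting it and cancelling \<open>x\<close>, which is not in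
    \<open>P1\<close>, passes to the remaining coefficients.\<close>
  have "h \<in> poly_ring T \<Longrightarrow> poly h x \<in> P1 \<Longrightarrow> h \<in> poly_ring (P1 \<inter> T)" for h
  proof (induction h)
    case 0
    then show ?case using i1 subringD(1)[OF T] by (auto intro: poly_ring_zero)
  next
    case (pCons a h)
    have hS: "poly h x \<in> S"
      using pCons.prems(1) poly_ring_mono[OF S(2)] by (intro poly_mem[OF S(1) xS subring_ideal[OF S(1)]]) auto
    have sum: "a + x * poly h x \<in> P1" using pCons.prems by simp
    have "a + x * poly h x - x * poly h x \<in> P2"
      using sum P(3) i2(5)[OF hS x(1)] ideal_of_diff[OF S(1) prime_ideal_ofD(1)[OF P(2)]] by blast
    then have a: "a \<in> P1 \<inter> T" using P(4) pCons.prems by auto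
    then have "a + x * poly h x - a \<in> P1"
      using sum ideal_of_diff[OF S(1) prime_ideal_ofD(1)[OF P(1)]] by blast
    then have "poly h x \<in> P1"
      using prime_ideal_ofD(3)[OF P(1) xS hS] x(2) by simp
    then show ?case using pCons a by simp
  qed
  from this[of "[:- x, 1:] * k"] show False
    using k i1(2) by simp
qed

text \<open>By incomparability, contracting a chain of primes to \<open>T\<close> keeps its
  inclusions strict.\<close>

lemma krull_dim_overring_le:
  assumes T: "subring T" and S: "subring S" "T \<subseteq> S" and up: "no_upper_in_extension T"
  shows "krull_dim S \<le> krull_dim T"
proof (rule krull_dim_le)
  fix n c assume c: "prime_chain S n c"
  have "prime_chain T n (\<lambda>i. c i \<inter> T)"
    unfolding prime_chain_def
  proof (intro conjI allI impI)
    show "prime_ideal_of T (c i \<inter> T)" if "i \<le> n" for i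
      using c that prime_ideal_contract[OF S(1) T S(2)] by (simp add: prime_chain_def)
    show "c i \<inter> T \<subset> c (Suc i) \<inter> T" if "i < n" for i
    proof -
      have "c i \<subset> c (Suc i)" "prime_ideal_of S (c i)" "prime_ideal_of S (c (Suc i))"
        using c that by (auto simp: prime_chain_def)
      then show ?thesis using incomparability[OF T S up] by blast
    qed
  qed
  then show "enat n \<le> krull_dim T" by (rule prime_chain_le_krull_dim)
qed

subsection \<open>A weak form of the Dedekind--Mertens lemma\<close>

text \<open>Induction on \<open>n + m\<close>, removing the top coefficient of \<open>k\<close> or
  of \<open>f\<close>. In terms of contents, \<open>c(f)^N c(k)\<close> is contained in
  \<open>T\<close>. That \<open>N\<close> depends only on the bounds \<open>n\<close> and
  \<open>m\<close> is essential, since the induction replaces both polynomials.\<close>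

lemma dedekind_mertens:
  assumes T: "subring (T :: 'k::field set)"
  shows "\<exists>N. \<forall>f k xs j. f \<in> poly_ring T \<longrightarrow> (\<forall>i\<ge>n. coeff f i = 0) \<longrightarrow> (\<forall>i\<ge>m. coeff k i = 0) \<longrightarrow>
    f * k \<in> poly_ring T \<longrightarrow> N \<le> length xs \<longrightarrow> set xs \<subseteq> range (coeff f) \<longrightarrow> prod_list xs * coeff k j \<in> T"
proof (induction "n + m" arbitrary: n m rule: less_induct)
  case less
  note t = subringD[OF T] and tx = subringD[OF subring_poly_ring[OF T]]
  consider "n = 0" | "m = 0" | n' m' where "n = Suc n'" "m = Suc m'"
    by (cases n; cases m) auto
  then show ?case
  proof cases
    case 1
    \<comment> \<open>Here \<open>f = 0\<close>; a single factor suffices to make the product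
      vanish.\<close>
    have "prod_list xs * coeff k j \<in> T"
      if "\<forall>i\<ge>n. coeff f i = 0" "1 \<le> length xs" "set xs \<subseteq> range (coeff f)" for f k :: "'k poly" and xs j
      using that t(1) 1 by (cases xs) auto
    then show ?thesis by blast
  next
    case 2
    then show ?thesis using t(1) by auto
  next
    case 3
    obtain N1 where N1: "\<And>f k xs j. f \<in> poly_ring T \<Longrightarrow> (\<forall>i\<ge>n. coeff f i = 0) \<Longrightarrow> (\<forall>i\<ge>m'. coeff k i = 0) \<Longrightarrow>
        f * k \<in> poly_ring T \<Longrightarrow> N1 \<le> length xs \<Longrightarrow> set xs \<subseteq> range (coeff f) \<Longrightarrow> prod_list xs * coeff k j \<in> T"
      using less[of n m'] 3 by (simp only: add_less_cancel_left lessI) blast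
    obtain N2 where N2: "\<And>f k xs j. f \<in> poly_ring T \<Longrightarrow> (\<forall>i\<ge>n'. coeff f i = 0) \<Longrightarrow> (\<forall>i\<ge>m. coeff k i = 0) \<Longrightarrow>
        f * k \<in> poly_ring T \<Longrightarrow> N2 \<le> length xs \<Longrightarrow> set xs \<subseteq> range (coeff f) \<Longrightarrow> prod_list xs * coeff k j \<in> T"
      using less[of n' m] 3 by (simp only: add_less_cancel_right lessI) blast
    have "prod_list xs * coeff k j \<in> T"
      if f: "f \<in> poly_ring T" and fn: "\<forall>i\<ge>n. coeff f i = 0" and km: "\<forall>i\<ge>m. coeff k i = 0"
        and fk: "f * k \<in> poly_ring T" and len: "Suc (N1 + N2) \<le> length xs" and xs: "set xs \<subseteq> range (coeff f)"
      for f k :: "'k poly" and xs j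
    proof -
      define a b where "a = coeff f n'" and "b = coeff k m'"
      have prodT: "prod_list ys \<in> T" if "set ys \<subseteq> range (coeff f)" for ys
        using that f t(2,4) by (induction ys) (auto simp: poly_ring_def)
      have aT: "a \<in> T" using f by (simp add: a_def poly_ring_def)
      have smultT: "smult c g \<in> poly_ring T" if "c \<in> T" "g \<in> poly_ring T" for c g
        using that t(4) by (auto simp: poly_ring_def)
      have "coeff (f * k) (n' + m') = (\<Sum>i\<le>n' + m'. coeff f i * coeff k (n' + m' - i))"
        by (rule coeff_mult)
      also have "\<dots> = (\<Sum>i\<in>{n'}. coeff f i * coeff k (n' + m' - i))"
      proof (rule sum.mono_neutral_right)
        show "\<forall>i\<in>{..n' + m'} - {n'}. coeff f i * coeff k (n' + m' - i) = 0"
        proof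
          fix i assume "i \<in> {..n' + m'} - {n'}"
          then consider "i \<ge> n" | "n' + m' - i \<ge> m" using 3 by force
          then show "coeff f i * coeff k (n' + m' - i) = 0" using fn km by cases auto
        qed
      qed auto
      finally have "coeff (f * k) (n' + m') = a * b" by (simp add: a_def b_def)
      then have ab: "a * b \<in> T"
        using fk unfolding poly_ring_def by (metis mem_Collect_eq)
      \<comment> \<open>Removing the top term of \<open>smult a k\<close> keeps the product with
        \<open>f\<close> over \<open>T\<close>, because \<open>a * b\<close> is in \<open>T\<close>.
        The induction hypothesis for \<open>k1\<close> then shows that \<open>N1\<close>
        coefficients of \<open>f\<close> together with one factor \<open>a\<close> suffice.\<close>
      define k1 where "k1 = smult a k - monom (a * b) m'"
      have "f * k1 = smult a (f * k) - monom (a * b) m' * f"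
        by (simp add: k1_def algebra_simps)
      moreover have "monom (a * b) m' \<in> poly_ring T" using ab t(1) by (simp add: poly_ring_def)
      ultimately have "f * k1 \<in> poly_ring T"
        using tx(4,6) smultT aT f fk by simp
      moreover have "coeff k1 i = 0" if "i \<ge> m'" for i
        using that km 3 by (cases "i = m'") (auto simp: k1_def b_def)
      ultimately have "prod_list ys * coeff k1 i \<in> T" if "N1 \<le> length ys" "set ys \<subseteq> range (coeff f)" for ys i
        using N1[OF f fn] that by blast
      moreover have "prod_list ys * coeff (monom (a * b) m') i \<in> T" if "set ys \<subseteq> range (coeff f)" for ys i
        using prodT[OF that] ab t(1,4) by simp
      ultimately have "prod_list ys * coeff k1 i + prod_list ys * coeff (monom (a * b) m') i \<in> T"
        if "N1 \<le> length ys" "set ys \<subseteq> range (coeff f)" for ys i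
        using that t(3) by blast
      moreover have "prod_list ys * coeff k1 i + prod_list ys * coeff (monom (a * b) m') i =
          prod_list ys * (a * coeff k i)" for ys i
        by (simp add: k1_def algebra_simps)
      ultimately have top: "prod_list ys * (a * coeff k i) \<in> T"
        if "N1 \<le> length ys" "set ys \<subseteq> range (coeff f)" for ys i
        using that by metis
      show ?thesis
      proof (cases "a \<in> set xs")
        case True
        then obtain ys zs where yz: "xs = ys @ a # zs" by (meson split_list)
        then have "prod_list (ys @ zs) * (a * coeff k j) \<in> T"
          using len xs by (intro top) auto
        then show ?thesis by (simp add: yz algebra_simps)
      next
        case False
        \<comment> \<open>Without a factor \<open>a\<close>, all entries of \<open>xs\<close> are
          coefficients of \<open>f1\<close>. The first \<open>N1\<close> entries, collected in
          \<open>c\<close>, bring \<open>smult (c * a) k\<close> into \<open>T[X]\<close>, so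
          \<open>f1 * smult c k\<close> is over \<open>T\<close>; the remaining entries serve the
          induction hypothesis for \<open>f1\<close>.\<close>
        define f1 where "f1 = f - monom a n'"
        define c where "c = prod_list (take N1 xs)"
        have sub: "set (take N1 xs) \<subseteq> range (coeff f)" using xs set_take_subset[of N1 xs] by blast
        have xs1: "set xs \<subseteq> range (coeff f1)"
        proof
          fix x assume "x \<in> set xs"
          then obtain i where "x = coeff f i" "x \<noteq> a" using xs False by blast
          then have "x = coeff f1 i" by (auto simp: f1_def a_def)
          then show "x \<in> range (coeff f1)" by blast
        qed
        have "monom a n' \<in> poly_ring T" using aT t(1) by (simp add: poly_ring_def)
        then have f1T: "f1 \<in> poly_ring T" using f tx(6) by (simp add: f1_def)
        have f1n: "\<forall>i\<ge>n'. coeff f1 i = 0"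
        proof (intro allI impI)
          fix i assume "n' \<le> i"
          then show "coeff f1 i = 0" using fn 3 by (cases "i = n'") (auto simp: f1_def a_def)
        qed
        have split: "f1 * smult c k = smult c (f * k) - monom 1 n' * smult (c * a) k"
          by (simp add: f1_def algebra_simps monom_altdef smult_monom)
        have "smult (c * a) k \<in> poly_ring T"
          using top[OF _ sub] len by (auto simp: poly_ring_def c_def algebra_simps)
        moreover have "monom 1 n' \<in> poly_ring T" using t(1,2) by (simp add: poly_ring_def)
        ultimately have "f1 * smult c k \<in> poly_ring T"
          unfolding split using fk prodT[OF sub, folded c_def] by (intro tx(6) tx(4) smultT[OF _ fk])
        moreover have "set (drop N1 xs) \<subseteq> range (coeff f1)" using xs1 set_drop_subset[of N1 xs] by blast
        ultimately have "prod_list (drop N1 xs) * coeff (smult c k) j \<in> T"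
          using f1T f1n km len by (intro N2[of f1]) auto
        moreover have "prod_list xs = c * prod_list (drop N1 xs)"
          unfolding c_def by (metis append_take_drop_id prod_list.append)
        ultimately show ?thesis by (simp add: algebra_simps)
      qed
    qed
    then show ?thesis by blast
  qed
qed

text \<open>Hypothesis \<open>inv\<close> says that \<open>(T : c(f))\<close> is contained in
  \<open>T\<close>. The Dedekind--Mertens bound multiplies each coefficient of \<open>k\<close> into
  \<open>T\<close> by all products of \<open>N\<close> coefficients of \<open>f\<close>, and
  \<open>inv\<close> strips off one factor at a time.\<close>

lemma gauss_trivial_inverse:
  fixes f k :: "'k::field poly"
  assumes T: "subring T" and f: "f \<in> poly_ring T" and fk: "f * k \<in> poly_ring T"
    and inv: "\<And>y. (\<And>i. y * coeff f i \<in> T) \<Longrightarrow> y \<in> T"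
  shows "k \<in> poly_ring T"
proof -
  obtain N where N: "\<And>xs j. N \<le> length xs \<Longrightarrow> set xs \<subseteq> range (coeff f) \<Longrightarrow> prod_list xs * coeff k j \<in> T"
    using dedekind_mertens[OF T, of "Suc (degree f)" "Suc (degree k)"] f fk
    by (metis Suc_le_eq coeff_eq_0)
  have "(\<And>xs. length xs = N \<Longrightarrow> set xs \<subseteq> range (coeff f) \<Longrightarrow> prod_list xs * y \<in> T) \<Longrightarrow> y \<in> T" for y
  proof (induction N)
    case 0
    then show ?case using "0"[of "[]"] by simp
  next
    case (Suc N)
    show ?case
    proof (rule Suc.IH)
      fix xs assume xs: "length xs = N" "set xs \<subseteq> range (coeff f)"
      show "prod_list xs * y \<in> T"
      proof (rule inv)
        fix i
        have "prod_list (coeff f i # xs) * y \<in> T" using xs by (intro Suc.prems) auto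
        then show "prod_list xs * y * coeff f i \<in> T" by (simp add: algebra_simps)
      qed
    qed
  qed
  then show ?thesis using N by (simp add: poly_ring_def)
qed

text \<open>Let \<open>f\<close> have content \<open>J\<close>. If \<open>J\<close> were proper, it
  would lie in a prime \<open>P\<close>, and some \<open>f * k\<close> would be in
  \<open>T[X]\<close> but not in \<open>P[X]\<close>. Since the v-closure of \<open>J\<close> is
  \<open>T\<close>, the multiplier \<open>k\<close> has coefficients in \<open>T\<close>, which
  forces \<open>f * k\<close> into \<open>P[X]\<close>.\<close>

lemma no_upper_dw_domain:
  assumes T: "subring T" and up: "no_upper_in_extension T"
  shows "dw_domain T"
  unfolding dw_domain_def
proof (intro allI impI)
  fix J assume "fg_ideal T J" "J \<noteq> {0}" and v: "v_op T J = T"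
  then obtain as where as: "set as \<subseteq> T" "J = gen_submod T as" by (auto simp: fg_ideal_def)
  have J: "ideal_of T J" using ideal_gen_submod[OF T as(1)] as(2) by simp
  define f where "f = Poly as"
  \<comment> \<open>Coefficients beyond the list default to 0, which is also in
    \<open>J\<close>.\<close>
  have coeff_f: "coeff f i \<in> J" for i
    using ideal_ofD(2)[OF J] gen_submod_generator[OF T, of _ as] as(2)
    by (auto simp: f_def nth_default_def)
  have as_coeff: "\<exists>i. coeff f i = a" if "a \<in> set as" for a
    using that by (auto simp: f_def in_set_conv_nth nth_default_def)
  have "f \<noteq> 0"
  proof
    assume "f = 0"
    then have "a = 0" if "a \<in> set as" for a using as_coeff[OF that] by simp
    then have "J \<subseteq> {0}" unfolding as(2) by (intro gen_submod_least) auto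
    then show False using \<open>J \<noteq> {0}\<close> ideal_ofD(2)[OF J] by blast
  qed
  show "1 \<in> J"
  proof (rule ccontr)
    assume "1 \<notin> J"
    \<comment> \<open>The valuation ring only serves to provide a prime of \<open>T\<close>
      containing \<open>J\<close>.\<close>
    then obtain W where W: "valuation_overring T W" "J \<subseteq> nonunits W"
      using valuation_existence[OF T J] by blast
    define P where "P = nonunits W \<inter> T"
    have P: "prime_ideal_of T P"
      unfolding P_def using prime_ideal_contract valuation_overringD[OF W(1)] T prime_nonunits[OF W(1)] by blast
    obtain k where k: "f * k \<in> poly_ring T - poly_ring P"
      using up P \<open>f \<noteq> 0\<close> unfolding no_upper_in_extension_def by blast
    have "k \<in> poly_ring T"
    proof (rule gauss_trivial_inverse[OF T])
      show "f \<in> poly_ring T" using coeff_f ideal_ofD(1)[OF J] by (auto simp: poly_ring_def)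
      show "f * k \<in> poly_ring T" using k by blast
      fix y assume y: "\<And>i. y * coeff f i \<in> T"
      have "J \<subseteq> {x. y * x \<in> T}"
        unfolding as(2)
      proof (rule gen_submod_least)
        show "r * a \<in> {x. y * x \<in> T}" if ra: "r \<in> T" "a \<in> set as" for r a
        proof -
          obtain i where "a = coeff f i" using as_coeff[OF ra(2)] by blast
          then have "r * (y * a) \<in> T" using y ra(1) subringD(4)[OF T] by blast
          then show ?thesis by (simp add: algebra_simps)
        qed
      qed (use subringD[OF T] in \<open>auto simp: distrib_left\<close>)
      then have "y \<in> colon T J" by (auto simp: colon_def)
      \<comment> \<open>This membership says that \<open>colon T J\<close> is contained in
        \<open>T\<close>.\<close>
      moreover have "1 \<in> v_op T J" using v subringD(2)[OF T] by simp
      ultimately show "y \<in> T" unfolding v_op_def colon_def[of T "colon T J"] by force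
    qed
    moreover have "f \<in> poly_ring P"
      using coeff_f W(2) ideal_ofD(1)[OF J] by (auto simp: poly_ring_def P_def)
    ultimately have "k * f \<in> poly_ring P"
      by (rule poly_ring_mult[OF T prime_ideal_ofD(1)[OF P]])
    then show False using k by (simp add: mult.commute)
  qed
qed

section \<open>The w-Jaffard property of overrings\<close>

lemma no_upper_w_Jaffard:
  assumes D: "subring D" and T: "subring T" "D \<subseteq> T" and up: "no_upper_in_extension D" and fin: "w_dim D < \<infinity>"
  shows "w_Jaffard T"
proof -
  have upT: "no_upper_in_extension T" by (rule no_upper_in_extension_overring[OF D T up])
  note dw = no_upper_dw_domain[OF T(1) upT]
  have w: "w_dim T = krull_dim T" by (rule dw_domain_w_dim[OF T(1) dw])
  have "w_dim D = krull_dim D" by (rule dw_domain_w_dim[OF D no_upper_dw_domain[OF D up]])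
  then have "w_dim T < \<infinity>"
    using fin w krull_dim_overring_le[OF D T up] by (metis order_le_less_trans)
  \<comment> \<open>Valuation overrings are themselves overrings of \<open>T\<close>, so the
    dimension bound applies to them.\<close>
  moreover have "w_dim_v T \<le> w_dim T"
    unfolding w dw_domain_w_dim_v[OF dw]
    using krull_dim_overring_le[OF T(1) _ _ upT] valuation_overringD by (intro Sup_least) blast
  moreover have "w_dim T \<le> w_dim_v T"
    unfolding w dw_domain_w_dim_v[OF dw]
  proof (rule krull_dim_le)
    fix n c assume "prime_chain T n c"
    then obtain V d where V: "valuation_overring T V" "prime_chain V n d"
      using valuation_chain[OF T(1)] by blast
    have "enat n \<le> krull_dim V" by (rule prime_chain_le_krull_dim[OF V(2)])
    also have "\<dots> \<le> Sup {krull_dim V | V. valuation_overring T V}"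
      using V(1) by (intro Sup_upper) blast
    finally show "enat n \<le> Sup {krull_dim V | V. valuation_overring T V}" .
  qed
  ultimately show ?thesis by (simp add: w_Jaffard_def)
qed

subsection \<open>An overring that is not w-Jaffard\<close>

lemma one_mem_ideal:
  assumes "ideal_of R I" "x \<in> I" "inverse x \<in> R" "x \<noteq> (0::'k::field)"
  shows "1 \<in> I"
  using ideal_ofD(4)[OF assms(1,3,2)] assms(4) by simp

text \<open>Only elements of \<open>nonunits V\<close>, hence of \<open>T\<close>, need the
  primality of \<open>p\<close> over \<open>T\<close>; a factor that is a unit of \<open>V\<close>
  can be cancelled once \<open>p\<close> absorbs \<open>V\<close>.\<close>

lemma prime_of_prime_in_valuation:
  assumes V: "valuation_overring R V" and T: "subring T" "T \<subseteq> V" "nonunits V \<subseteq> T"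
    and p: "prime_ideal_of T p" "p \<subseteq> nonunits V"
  shows "prime_ideal_of V p"
proof -
  note v = subringD[OF valuation_overringD(1)[OF V]]
  note i = ideal_ofD[OF prime_ideal_ofD(1)[OF p(1)]]
  note m = ideal_ofD[OF prime_ideal_ofD(1)[OF prime_nonunits[OF V]]]
  \<comment> \<open>The multiplier \<open>y\<close> need not be in \<open>T\<close>, but
    \<open>y * (y * x)\<close> is; multiplied by \<open>x\<close> it gives the square of
    \<open>y * x\<close>, and primality extracts the root.\<close>
  have mult: "y * x \<in> p" if "y \<in> V" "x \<in> p" for x y
  proof -
    have "y * x \<in> T" "y * (y * x) \<in> T"
      using m(4) that p(2) T(3) by blast+
    moreover from this have "(y * (y * x)) * x \<in> p" using i(4) that by blast
    then have "(y * x) * (y * x) \<in> p" by (simp add: algebra_simps)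
    ultimately show ?thesis using prime_ideal_ofD(3)[OF p(1)] by blast
  qed
  have cancel: "x \<in> p" if "x \<in> V" "y \<in> V" "y \<notin> nonunits V" "x * y \<in> p" for x y
  proof -
    have "inverse y \<in> V" "y \<noteq> 0" using inverse_mem_of_unit that by blast+
    then have "inverse y * (x * y) \<in> p" "inverse y * (x * y) = x" using mult[OF _ that(4)] by auto
    then show ?thesis by simp
  qed
  show ?thesis
  proof (rule prime_ideal_ofI[OF valuation_overringD(1)[OF V]])
    show "ideal_of V p" using mult i(2,3) p(2) nonunits_subset[of V] unfolding ideal_of_def by blast
    show "1 \<notin> p" by (rule one_notin_prime[OF p(1)])
    show "x \<in> p \<or> y \<in> p" if xy: "x \<in> V" "y \<in> V" "x * y \<in> p" for x y
    proof (cases "x \<in> nonunits V \<and> y \<in> nonunits V")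
      case True
      then show ?thesis using prime_ideal_ofD(3)[OF p(1)] xy(3) T(3) by blast
    next
      case False
      then show ?thesis using cancel[of x y] cancel[of y x] xy by (auto simp: mult.commute)
    qed
  qed
qed

lemma exists_overring_not_w_Jaffard:
  assumes D: "subring D" and V1: "valuation_overring D V1" and V2: "valuation_overring D V2"
    and sub: "V2 \<subset> V1" and center: "nonunits V1 \<inter> D = nonunits V2 \<inter> D"
  shows "\<exists>T. subring T \<and> D \<subseteq> T \<and> \<not> w_Jaffard T"
proof -
  let ?M = "nonunits V1"
  define P where "P = ?M \<inter> D"
  have P: "prime_ideal_of D P"
    unfolding P_def using prime_ideal_contract valuation_overringD[OF V1] D prime_nonunits[OF V1] by blast
  define T where "T = glue D P ?M"
  have T: "subring T" "T \<subseteq> V1"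
    unfolding T_def using subring_glue[OF D V1 P] glue_subset[OF D V1 P] by (simp_all add: P_def)
  note t = subringD[OF T(1)] and v2 = subringD[OF valuation_overringD(1)[OF V2]]
  note m = ideal_ofD[OF prime_ideal_ofD(1)[OF prime_nonunits[OF V1]]]
  have M12: "?M \<subseteq> nonunits V2" using nonunits_antimono[OF V2] sub by blast
  have one: "1 \<in> D - P" using subringD(2)[OF D] one_notin_prime[OF P] by blast
  have "x - x / 1 \<in> ?M" for x using m(2) by simp
  then have DT: "D \<subseteq> T" unfolding T_def glue_def using one by blast
  have "x - 0 / 1 \<in> ?M" if "x \<in> ?M" for x using that by simp
  then have MT: "?M \<subseteq> T" unfolding T_def glue_def using one subringD(1)[OF D] by blast
  have unit: "s \<noteq> 0" "inverse s \<in> V2" if "s \<in> D - P" for s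
    using inverse_mem_of_unit[of s V2] that valuation_overringD(2)[OF V2] center by (auto simp: P_def)
  \<comment> \<open>The common center makes the denominators units of \<open>V2\<close> as
    well.\<close>
  have TV2: "T \<subseteq> V2"
  proof
    fix x assume "x \<in> T"
    then obtain a s where as: "a \<in> D" "s \<in> D - P" "x - a / s \<in> ?M" by (auto simp: T_def glue_def)
    then have "a * inverse s \<in> V2" using unit valuation_overringD(2)[OF V2] v2(4) by blast
    moreover have "x - a / s \<in> V2" using as M12 nonunits_subset by blast
    ultimately have "(x - a / s) + a * inverse s \<in> V2" using v2(3) by blast
    then show "x \<in> V2" by (simp add: divide_inverse)
  qed
  \<comment> \<open>\<open>T\<close> is local with maximal ideal \<open>?M\<close>: an element
    congruent to \<open>a / s\<close> outside \<open>?M\<close> has \<open>a\<close> outside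
    \<open>P\<close>, and its inverse is congruent to \<open>s / a\<close>.\<close>
  have T_local: "inverse x \<in> T" "x \<noteq> 0" if x: "x \<in> T" "x \<notin> ?M" for x
  proof -
    obtain a s where as: "a \<in> D" "s \<in> D - P" "x - a / s \<in> ?M"
      using x by (auto simp: T_def glue_def)
    have ix: "inverse x \<in> V1" "x \<noteq> 0" using inverse_mem_of_unit x T(2) by blast+
    have iv: "inverse u \<in> V1" if "u \<in> D - P" for u using unit that sub by blast
    have "a \<notin> P"
    proof
      assume "a \<in> P"
      then have "inverse s * a \<in> ?M" using iv as by (intro m(4)) (auto simp: P_def)
      then have "(x - a / s) + inverse s * a \<in> ?M" using as m(3) by blast
      then show False using x by (simp add: divide_inverse mult.commute)
    qed
    then have a: "a \<in> D - P" using as by blast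
    have "(- s * (inverse x * inverse a)) * (x - a / s) \<in> ?M"
    proof (rule m(4))
      have "s \<in> V1" using as valuation_overringD(2)[OF V1] by blast
      then show "- s * (inverse x * inverse a) \<in> V1"
        using ix iv[OF a] subringD(4,5)[OF valuation_overringD(1)[OF V1]] by simp
    qed (rule as)
    moreover have "(- s * (inverse x * inverse a)) * (x - a / s) = inverse x - s / a"
      using ix unit(1)[OF a] unit(1)[OF as(2)] by (simp add: field_simps)
    ultimately have "inverse x - s / a \<in> ?M" by simp
    then show "inverse x \<in> T" "x \<noteq> 0" using a as ix unfolding T_def glue_def by blast+
  qed
  have "dw_domain T"
    unfolding dw_domain_def
  proof (intro allI impI)
    fix J assume "fg_ideal T J" and v: "v_op T J = T"
    then have J: "ideal_of T J" using ideal_gen_submod[OF T(1)] by (auto simp: fg_ideal_def)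
    \<comment> \<open>\<open>V1\<close> multiplies \<open>?M\<close> into \<open>T\<close>, so for
      \<open>J\<close> inside \<open>?M\<close> the colon would contain \<open>V1\<close>, whereas
      \<open>J\<close> having v-closure \<open>T\<close> keeps the colon inside
      \<open>T\<close>.\<close>
    have "\<not> J \<subseteq> ?M"
    proof
      assume "J \<subseteq> ?M"
      then have "V1 \<subseteq> colon T J" using m(4) MT unfolding colon_def by blast
      moreover have "1 \<in> colon T (colon T J)" using v t(2) by (simp add: v_op_def)
      ultimately have "V1 \<subseteq> T" unfolding colon_def[of T "colon T J"] by force
      then show False using TV2 sub by blast
    qed
    then obtain j where j: "j \<in> J" "j \<notin> ?M" by blast
    then have "inverse j \<in> T" "j \<noteq> 0" using T_local ideal_ofD(1)[OF J] by blast+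
    then show "1 \<in> J" by (rule one_mem_ideal[OF J j(1)])
  qed
  note w = dw_domain_w_dim[OF T(1) this] dw_domain_w_dim_v[OF this]
  \<comment> \<open>All primes of the local ring \<open>T\<close> lie in \<open>?M\<close>, so they
    are primes of \<open>V1\<close> and then of \<open>V2\<close>. The maximal ideal of
    \<open>V2\<close> is strictly larger than \<open>?M\<close> and lengthens the chain by
    one.\<close>
  have extend: "enat (Suc n) \<le> krull_dim V2" if c: "prime_chain T n c" for n c
  proof -
    have primes: "prime_ideal_of V2 (c i) \<and> c i \<subseteq> ?M" if "i \<le> n" for i
    proof -
      have p: "prime_ideal_of T (c i)" using c that by (simp add: prime_chain_def)
      have "c i \<subseteq> ?M"
      proof (rule ccontr)
        assume "\<not> c i \<subseteq> ?M"
        then obtain x where x: "x \<in> c i" "x \<notin> ?M" by blast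
        then have "inverse x \<in> T" "x \<noteq> 0" using T_local prime_ideal_ofD(2)[OF p] by blast+
        then show False
          using one_mem_ideal[OF prime_ideal_ofD(1)[OF p] x(1)] one_notin_prime[OF p] by blast
      qed
      moreover from this have "prime_ideal_of V1 (c i)"
        by (rule prime_of_prime_in_valuation[OF V1 T MT p])
      then have "prime_ideal_of V2 (c i)"
        using prime_restrict[OF valuation_overringD(1)[OF V2]] sub prime_ideal_ofD(2)[OF p] TV2 by blast
      ultimately show ?thesis by blast
    qed
    have "prime_chain V2 n c" using primes c by (simp add: prime_chain_def)
    moreover have "c n \<subset> nonunits V2"
    proof -
      obtain x where x: "x \<in> V1" "x \<notin> V2" using sub by blast
      then have "inverse x \<in> nonunits V2" using valuation_overringD(3)[OF V2] by blast
      moreover have "inverse x \<notin> ?M"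
        using x v2(1) by (auto simp: nonunits_def)
      ultimately show ?thesis using primes[of n] M12 by blast
    qed
    ultimately have "prime_chain V2 (Suc n) (c(Suc n := nonunits V2))"
      using prime_chain_extend prime_nonunits[OF V2] by blast
    then show ?thesis by (rule prime_chain_le_krull_dim)
  qed
  have "\<not> w_Jaffard T"
  proof
    assume "w_Jaffard T"
    then have "krull_dim T = w_dim_v T" "krull_dim T < \<infinity>"
      unfolding w_Jaffard_def w(1) by blast+
    moreover have "krull_dim V2 \<le> w_dim_v T"
      unfolding w(2) using TV2 by (intro Sup_upper) (blast intro: valuation_overring_mono[OF V2])
    ultimately obtain N where N: "krull_dim T = enat N" "krull_dim V2 \<le> enat N"
      by (metis enat_ord_simps(4) not_infinity_eq)
    \<comment> \<open>Every chain of \<open>T\<close> would be shorter than \<open>N\<close> by at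
      least one, although \<open>N\<close> is the dimension of \<open>T\<close>.\<close>
    have bound: "Suc n \<le> N" if "prime_chain T n c" for n c
      using order_trans[OF extend[OF that] N(2)] by simp
    have "prime_ideal_of T ?M"
    proof (rule prime_restrict[OF T(1) T(2) prime_nonunits[OF V1] MT])
    qed
    \<comment> \<open>The one-member chain makes \<open>N\<close> positive, so that
      \<open>N - 1\<close> is not truncated.\<close>
    then have "prime_chain T 0 (\<lambda>_. ?M)" by (simp add: prime_chain_def)
    then have "N > 0" using bound by fastforce
    have "krull_dim T \<le> enat (N - 1)"
    proof (rule krull_dim_le)
      fix n c assume "prime_chain T n c"
      then show "enat n \<le> enat (N - 1)" using bound[of n c] by simp
    qed
    then show False using N(1) \<open>N > 0\<close> by simp
  qed
  then show ?thesis using T(1) DT by blast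
qed

subsection \<open>Valuation rings of the rational function field\<close>

lemma inj_to_fract: "inj to_fract"
  by (simp add: inj_def)

lemma to_fract_mem_image [simp]: "to_fract x \<in> to_fract ` S \<longleftrightarrow> x \<in> S"
  by (simp add: inj_image_mem_iff[OF inj_to_fract])

lemma subring_to_fract:
  assumes "subring R"
  shows "subring (to_fract ` R)"
  unfolding subring_def
proof (intro conjI ballI)
  note r = subringD[OF assms]
  show "0 \<in> to_fract ` R" "1 \<in> to_fract ` R" using r(1,2) by (metis imageI to_fract_0, metis imageI to_fract_1)
  fix x y assume "x \<in> to_fract ` R" "y \<in> to_fract ` R"
  then obtain a b where "x = to_fract a" "y = to_fract b" "a \<in> R" "b \<in> R" by blast
  then show "x + y \<in> to_fract ` R" "x * y \<in> to_fract ` R" "- x \<in> to_fract ` R"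
    using r(3-5) by (metis imageI to_fract_add, metis imageI to_fract_mult, metis imageI to_fract_uminus)
qed

lemma prime_to_fract:
  assumes R: "subring R" and P: "prime_ideal_of R P"
  shows "prime_ideal_of (to_fract ` R) (to_fract ` P)"
proof (rule prime_ideal_ofI[OF subring_to_fract[OF R]])
  note i = ideal_ofD[OF prime_ideal_ofD(1)[OF P]]
  show "ideal_of (to_fract ` R) (to_fract ` P)"
    unfolding ideal_of_def
  proof (intro conjI ballI)
    show "to_fract ` P \<subseteq> to_fract ` R" using i(1) by blast
    show "0 \<in> to_fract ` P" using i(2) by (metis imageI to_fract_0)
    show "x + y \<in> to_fract ` P" if "x \<in> to_fract ` P" "y \<in> to_fract ` P" for x y
      using that i(3) by (auto simp flip: to_fract_add)
    show "x * y \<in> to_fract ` P" if "x \<in> to_fract ` R" "y \<in> to_fract ` P" for x y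
      using that i(4) by (auto simp flip: to_fract_mult)
  qed
  show "1 \<notin> to_fract ` P"
    using one_notin_prime[OF P] to_fract_mem_image[of 1 P] by simp
  show "x \<in> to_fract ` P \<or> y \<in> to_fract ` P"
    if "x \<in> to_fract ` R" "y \<in> to_fract ` R" "x * y \<in> to_fract ` P" for x y
    using that prime_ideal_ofD(3)[OF P] by (force simp flip: to_fract_mult)
qed

abbreviation const_fract :: "'k::field \<Rightarrow> 'k poly fract" where
  "const_fract x \<equiv> to_fract [:x:]"

lemma const_fract_mult: "const_fract (x * y) = const_fract x * const_fract y"
  by (simp flip: to_fract_mult)

lemma const_fract_add: "const_fract (x + y) = const_fract x + const_fract y"
  by (simp flip: to_fract_add)

lemma const_fract_inverse: "const_fract (inverse x) = inverse (const_fract x)"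
proof (cases "x = 0")
  case False
  then have "const_fract x * const_fract (inverse x) = 1"
    by (simp flip: const_fract_mult one_pCons)
  then show ?thesis by (metis inverse_unique)
qed simp

lemma valuation_restrict_to_constants:
  fixes D :: "'k::field set"
  assumes "subring D" and W: "valuation_overring (to_fract ` poly_ring D) W"
  shows "valuation_overring D {x. const_fract x \<in> W}"
    and "nonunits {x. const_fract x \<in> W} = {x. const_fract x \<in> nonunits W}"
proof -
  note w = subringD[OF valuation_overringD(1)[OF W]]
  let ?V = "{x. const_fract x \<in> W}"
  have "subring ?V"
    unfolding subring_def
    using w(1-4) w(5)[of "const_fract x" for x]
    by (auto simp: const_fract_mult const_fract_add simp flip: one_pCons to_fract_uminus)
  moreover have "D \<subseteq> ?V"
    using valuation_overringD(2)[OF W] subringD(1)[OF assms(1)] by (auto simp: poly_ring_zero image_subset_iff)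
  moreover have "x \<in> ?V \<or> inverse x \<in> ?V" if "x \<noteq> 0" for x
    using W that unfolding valuation_overring_def by (simp add: const_fract_inverse)
  ultimately show "valuation_overring D ?V" by (simp add: valuation_overring_def)
  show "nonunits ?V = {x. const_fract x \<in> nonunits W}"
    by (auto simp: nonunits_def const_fract_inverse)
qed

text \<open>A coefficient of least value, found by comparing each new coefficient with the previous
  minimum; dividing by it makes \<open>f\<close> primitive over \<open>V\<close>.\<close>

lemma exists_minimal_coeff:
  assumes V: "valuation_overring R V" and "f \<noteq> 0"
  shows "\<exists>i. coeff f i \<noteq> 0 \<and> (\<forall>k. coeff f k / coeff f i \<in> V)"
  using assms(2)
proof (induction f)
  case (pCons a f)
  note v = subringD[OF valuation_overringD(1)[OF V]]
  show ?case
  proof (cases "f = 0")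
    case True
    then show ?thesis using pCons v(1,2)
      by (intro exI[of _ 0]) (auto simp: coeff_pCons split: nat.splits)
  next
    case False
    then obtain i where i: "coeff f i \<noteq> 0" "\<And>k. coeff f k / coeff f i \<in> V" using pCons by blast
    show ?thesis
    proof (cases "a / coeff f i \<in> V")
      case True
      then show ?thesis using i by (intro exI[of _ "Suc i"]) (auto simp: coeff_pCons split: nat.splits)
    next
      case False
      then have "a \<noteq> 0" using v(1) by auto
      have "inverse (a / coeff f i) \<in> V" using valuation_overringD(3)[OF V False] nonunits_subset by blast
      then have "(coeff f k / coeff f i) * inverse (a / coeff f i) \<in> V" for k
        using i(2) v(4) by blast
      moreover have "(coeff f k / coeff f i) * inverse (a / coeff f i) = coeff f k / a" for k
        using i(1) by (simp add: field_simps)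
      ultimately show ?thesis using \<open>a \<noteq> 0\<close> v(2)
        by (intro exI[of _ 0]) (auto simp: coeff_pCons split: nat.splits)
    qed
  qed
qed auto

text \<open>The ideal \<open>(P, X)\<close>, the preimage of \<open>P\<close> under evaluation at
  zero.\<close>

lemma prime_ideal_constant_coeff:
  assumes D: "subring D" and P: "prime_ideal_of D P"
  shows "prime_ideal_of (poly_ring D) {f \<in> poly_ring D. coeff f 0 \<in> P}"
proof (rule prime_ideal_ofI[OF subring_poly_ring[OF D]])
  note i = ideal_ofD[OF prime_ideal_ofD(1)[OF P]] and dx = subringD[OF subring_poly_ring[OF D]]
  have c: "coeff f 0 \<in> D" if "f \<in> poly_ring D" for f using that by (simp add: poly_ring_def)
  show "ideal_of (poly_ring D) {f \<in> poly_ring D. coeff f 0 \<in> P}"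
    unfolding ideal_of_def using i(2-4) dx(1,3,4) c by (auto simp: coeff_mult)
  show "1 \<notin> {f \<in> poly_ring D. coeff f 0 \<in> P}" using one_notin_prime[OF P] by simp
  show "f \<in> {f \<in> poly_ring D. coeff f 0 \<in> P} \<or> g \<in> {f \<in> poly_ring D. coeff f 0 \<in> P}"
    if "f \<in> poly_ring D" "g \<in> poly_ring D" "f * g \<in> {f \<in> poly_ring D. coeff f 0 \<in> P}" for f g
    using that prime_ideal_ofD(3)[OF P c c] by (auto simp: coeff_mult)
qed

section \<open>From incomparable valuation overrings to extended primes\<close>

lemma quasi_Pruefer_if_valuations_incomparable:
  fixes D :: "'k::field set"
  assumes D: "subring D"
    and inc: "\<And>V1 V2. valuation_overring D V1 \<Longrightarrow> valuation_overring D V2 \<Longrightarrow> V2 \<subseteq> V1 \<Longrightarrow>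
      nonunits V1 \<inter> D = nonunits V2 \<inter> D \<Longrightarrow> V1 = V2"
  shows "quasi_Pruefer D"
  unfolding quasi_Pruefer_def
proof (intro allI impI)
  fix P :: "'k set" and Q :: "'k poly set"
  assume P: "prime_ideal_of D P" and Q: "prime_ideal_of (poly_ring D) Q" and QP: "Q \<subseteq> poly_ring P"
  define q where "q = {a \<in> D. [:a:] \<in> Q}"
  note DX = subring_poly_ring[OF D]
  note d = subringD[OF D]
  note iQ = ideal_ofD[OF prime_ideal_ofD(1)[OF Q]] and iP = ideal_ofD[OF prime_ideal_ofD(1)[OF P]]
  have X: "[:0, 1:] \<in> poly_ring D" using d(1,2) by (simp add: poly_ring_zero)
  have "poly_ring q \<subseteq> Q"
  proof
    fix f assume "f \<in> poly_ring q"
    then show "f \<in> Q"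
    proof (induction f)
      case 0
      then show ?case using iQ(2) by simp
    next
      case (pCons a f)
      then have "[:a:] \<in> Q" "[:0, 1:] * f \<in> Q" using iQ(4)[OF X] by (auto simp: q_def)
      then have "[:a:] + [:0, 1:] * f \<in> Q" by (rule iQ(3))
      then show ?case by simp
    qed
  qed
  moreover have "Q \<subseteq> poly_ring q"
  proof (rule ccontr)
    assume "\<not> Q \<subseteq> poly_ring q"
    then obtain f j where f: "f \<in> Q" "coeff f j \<notin> q" by (auto simp: poly_ring_def)
    define R where "R = to_fract ` poly_ring D"
    define N where "N = {f \<in> poly_ring D. coeff f 0 \<in> P}"
    have PN: "poly_ring P \<subseteq> N" using iP(1) by (auto simp: N_def poly_ring_def)
    have R: "subring R" unfolding R_def by (rule subring_to_fract[OF DX])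
    have prR: "prime_ideal_of R (to_fract ` Q)" "prime_ideal_of R (to_fract ` poly_ring P)"
      "prime_ideal_of R (to_fract ` N)"
      using prime_to_fract[OF DX] Q prime_poly_ring[OF D P] prime_ideal_constant_coeff[OF D P]
      by (auto simp: R_def N_def)
    obtain W0 where W0: "valuation_overring R W0" "nonunits W0 \<inter> R = to_fract ` Q"
      using exists_valuation_centered[OF R prR(1)] by blast
    have "nonunits W0 \<inter> R \<subseteq> to_fract ` poly_ring P" using W0(2) QP by blast
    from valuation_refine[OF R W0(1) prR(2) this] obtain W1 where
      W1: "valuation_overring R W1" "W1 \<subseteq> W0" "nonunits W1 \<inter> R = to_fract ` poly_ring P" by blast
    have "nonunits W1 \<inter> R \<subseteq> to_fract ` N" using W1(3) PN by blast
    from valuation_refine[OF R W1(1) prR(3) this] obtain W2 where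
      W2: "valuation_overring R W2" "W2 \<subseteq> W1" "nonunits W2 \<inter> R = to_fract ` N" by blast
    have sub: "nonunits W0 \<subseteq> nonunits W1" "nonunits W1 \<subseteq> nonunits W2"
      using nonunits_antimono[OF W1(1,2)] nonunits_antimono[OF W2(1,2)] by auto
    let ?V = "\<lambda>W. {x. const_fract x \<in> W}"
    note restr = valuation_restrict_to_constants[OF D, folded R_def]
    have cR: "const_fract x \<in> R" if "x \<in> D" for x using that d(1) by (simp add: R_def poly_ring_zero)
    have "x \<in> nonunits (?V W1) \<longleftrightarrow> x \<in> P" "x \<in> nonunits (?V W2) \<longleftrightarrow> x \<in> P" if "x \<in> D" for x
    proof -
      have "x \<in> nonunits (?V W1) \<longleftrightarrow> const_fract x \<in> nonunits W1 \<inter> R"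
        using cR[OF that] restr(2)[OF W1(1)] by auto
      then show "x \<in> nonunits (?V W1) \<longleftrightarrow> x \<in> P"
        unfolding W1(3) using iP(2) by (simp add: poly_ring_zero)
      have "x \<in> nonunits (?V W2) \<longleftrightarrow> const_fract x \<in> nonunits W2 \<inter> R"
        using cR[OF that] restr(2)[OF W2(1)] by auto
      then show "x \<in> nonunits (?V W2) \<longleftrightarrow> x \<in> P"
        unfolding W2(3) using that d(1) by (simp add: N_def poly_ring_zero)
    qed
    \<comment> \<open>Both traces on \<open>K\<close> have center \<open>P\<close> on
      \<open>D\<close>, so incomparability identifies them.\<close>
    then have VW: "?V W1 = ?V W2"
      using W2(2) by (intro inc[OF restr(1)[OF W1(1)] restr(1)[OF W2(1)]]) auto
    define V where "V = ?V W1"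
    have V: "valuation_overring D V" unfolding V_def by (rule restr(1)[OF W1(1)])
    have nV: "nonunits V = {x. const_fract x \<in> nonunits W1}" "nonunits V = {x. const_fract x \<in> nonunits W2}"
      unfolding V_def using restr(2)[OF W1(1)] restr(2)[OF W2(1)] VW by auto
    define X' :: "'k poly fract" where "X' = to_fract [:0, 1:]"
    have XR: "X' \<in> R" using X by (simp add: X'_def R_def)
    \<comment> \<open>\<open>X\<close> is outside \<open>P[X]\<close> but inside
      \<open>(P, X)\<close>: it is a unit of \<open>W1\<close> and a nonunit of \<open>W2\<close>,
      although both rings have the same constants.\<close>
    have XW1: "X' \<notin> nonunits W1"
    proof
      assume "X' \<in> nonunits W1"
      then have "X' \<in> to_fract ` poly_ring P" using W1(3) XR by blast
      then show False using one_notin_prime[OF P] by (simp add: X'_def)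
    qed
    have XW2: "X' \<in> nonunits W2"
    proof -
      have "X' \<in> to_fract ` N" using X iP(2) by (simp add: X'_def N_def)
      then show ?thesis using W2(3) by blast
    qed
    note w2 = subringD[OF valuation_overringD(1)[OF W2(1)]]
    note n1 = ideal_ofD[OF prime_ideal_ofD(1)[OF prime_nonunits[OF W1(1)]]]
    note n2 = ideal_ofD[OF prime_ideal_ofD(1)[OF prime_nonunits[OF W2(1)]]]
    have expand: "to_fract (pCons a g) = const_fract a + X' * to_fract g" for a :: 'k and g
      by (simp add: X'_def flip: to_fract_mult to_fract_add)
    have polyW2: "g \<in> poly_ring V \<Longrightarrow> to_fract g \<in> W2" for g
    proof (induction g)
      case (pCons a g)
      then have "const_fract a \<in> W2" "to_fract g \<in> W2" using VW by (auto simp: V_def)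
      then show ?case unfolding expand[of a g] using XW2 nonunits_subset w2(3,4) by blast
    qed (simp add: w2(1))
    \<comment> \<open>In \<open>W2\<close> the variable is a nonunit, so the constant term is a
      nonunit of \<open>W2\<close> and, the traces agreeing, of \<open>V\<close> and
      \<open>W1\<close>. After subtracting it, the variable is cancelled in \<open>W1\<close>, where
      it is a unit.\<close>
    have primitive: "g \<in> poly_ring V \<Longrightarrow> to_fract g \<in> nonunits W1 \<Longrightarrow> g \<in> poly_ring (nonunits V)" for g
    proof (induction g)
      case 0
      then show ?case using nV(1) n1(2) by (simp add: poly_ring_zero)
    next
      case (pCons a g)
      have g: "to_fract g \<in> W2" using polyW2 pCons.prems by simp
      have *: "const_fract a + X' * to_fract g \<in> nonunits W1" using pCons.prems(2) unfolding expand[of a g] .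
      have "X' * to_fract g \<in> nonunits W2" using g XW2 by (rule n2(5))
      then have "const_fract a + X' * to_fract g - X' * to_fract g \<in> nonunits W2"
        using * sub(2) ideal_of_diff[OF valuation_overringD(1)[OF W2(1)] prime_ideal_ofD(1)[OF prime_nonunits[OF W2(1)]]]
        by blast
      then have a: "a \<in> nonunits V" using nV(2) by simp
      then have "const_fract a \<in> nonunits W1" using nV(1) by simp
      then have "const_fract a + X' * to_fract g - const_fract a \<in> nonunits W1"
        using * ideal_of_diff[OF valuation_overringD(1)[OF W1(1)] prime_ideal_ofD(1)[OF prime_nonunits[OF W1(1)]]]
        by blast
      then have "X' * to_fract g \<in> nonunits W1" by simp
      moreover have "X' \<in> W1" "to_fract g \<in> W1" using XW2 nonunits_subset g W2(2) by blast+
      ultimately have "to_fract g \<in> nonunits W1"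
        using prime_ideal_ofD(3)[OF prime_nonunits[OF W1(1)]] XW1 by blast
      then show ?case using pCons a by simp
    qed
    have "f \<noteq> 0" using f(2) d(1) iQ(2) by (auto simp: q_def)
    then obtain i where i: "coeff f i \<noteq> 0" "\<And>k. coeff f k / coeff f i \<in> V"
      using exists_minimal_coeff[OF V] by blast
    \<comment> \<open>The coefficient \<open>coeff f j\<close> lies in \<open>D\<close> but not in
      \<open>Q\<close>, so it is a unit of \<open>W0\<close>. As \<open>coeff f i\<close> divides it
      in \<open>V\<close>, and constants from \<open>V\<close> lie in \<open>W0\<close>,
      \<open>coeff f i\<close> is inverted there too.\<close>
    have "inverse (coeff f i) \<in> ?V W0"
    proof -
      let ?c = "coeff f j"
      have cD: "?c \<in> D" using f(1) iQ(1) by (auto simp: poly_ring_def)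
      then have "const_fract ?c \<in> R" by (rule cR)
      moreover have "const_fract ?c \<notin> to_fract ` Q" using f(2) cD by (simp add: q_def)
      ultimately have "const_fract ?c \<in> W0" "const_fract ?c \<notin> nonunits W0"
        using W0 valuation_overringD(2)[OF W0(1)] by blast+
      then have "const_fract (inverse ?c) \<in> W0" "const_fract ?c \<noteq> 0"
        using inverse_mem_of_unit[of "const_fract ?c" W0] by (simp_all add: const_fract_inverse)
      moreover have "const_fract (?c / coeff f i) \<in> W0" using i(2) W1(2) by (auto simp: V_def)
      ultimately have "const_fract (inverse ?c * (?c / coeff f i)) \<in> W0"
        unfolding const_fract_mult using subringD(4)[OF valuation_overringD(1)[OF W0(1)]] by blast
      moreover have "inverse ?c * (?c / coeff f i) = inverse (coeff f i)"
        using \<open>const_fract ?c \<noteq> 0\<close> by (simp add: field_simps)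
      ultimately show ?thesis by simp
    qed
    moreover have "to_fract f \<in> nonunits W0" using f(1) W0(2) by blast
    ultimately have "const_fract (inverse (coeff f i)) * to_fract f \<in> nonunits W0"
      using ideal_ofD(4)[OF prime_ideal_ofD(1)[OF prime_nonunits[OF W0(1)]]] by blast
    then have "to_fract (smult (inverse (coeff f i)) f) \<in> nonunits W1"
      using sub(1) by (auto simp flip: to_fract_mult)
    moreover have "smult (inverse (coeff f i)) f \<in> poly_ring V"
      using i(2) by (simp add: poly_ring_def divide_inverse mult.commute)
    ultimately have "smult (inverse (coeff f i)) f \<in> poly_ring (nonunits V)" using primitive by blast
    \<comment> \<open>The coefficient in degree \<open>i\<close> is 1 after the division, which
      cannot be a nonunit.\<close>
    then have "coeff (smult (inverse (coeff f i)) f) i \<in> nonunits V" unfolding poly_ring_def by blast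
    then have "inverse (coeff f i) * coeff f i \<in> nonunits V" by simp
    then show False using i(1) one_notin_prime[OF prime_nonunits[OF V]] by simp
  qed
  ultimately show "Q = poly_ring {a \<in> D. [:a:] \<in> Q}" by (simp add: q_def)
qed

theorem theorem2p1:
  fixes D :: "'k::field set"
  assumes "subring D"
    and "\<forall>x. \<exists>a\<in>D. \<exists>b\<in>D. b \<noteq> 0 \<and> x = a / b"
    and "w_dim D < \<infinity>"
  shows "(\<forall>T. subring T \<and> D \<subseteq> T \<longrightarrow> w_Jaffard T) \<longleftrightarrow> quasi_Pruefer D"
proof
  assume Jaffard: "\<forall>T. subring T \<and> D \<subseteq> T \<longrightarrow> w_Jaffard T"
  show "quasi_Pruefer D"
  proof (rule quasi_Pruefer_if_valuations_incomparable[OF assms(1)])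
    fix V1 V2
    assume "valuation_overring D V1" "valuation_overring D V2" "V2 \<subseteq> V1" "nonunits V1 \<inter> D = nonunits V2 \<inter> D"
    then show "V1 = V2"
      using exists_overring_not_w_Jaffard[OF assms(1), of V1 V2] Jaffard by blast
  qed
next
  assume "quasi_Pruefer D"
  then have "no_upper_in_extension D" by (rule quasi_Pruefer_no_upper[OF assms(1,2)])
  then show "\<forall>T. subring T \<and> D \<subseteq> T \<longrightarrow> w_Jaffard T"
    using no_upper_w_Jaffard[OF assms(1)] assms(3) by blast
qed

end
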